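(* For each constant $p$, PCP restricted to instances whose partition has $p$ parts is solvable in polynomial time.
   Context: The Partition Coloring Problem (PCP): given a simple undirected graph $G=(V,E)$, a partition $\mathcal{V}=\{V_1,\dots,V_p\}$ of $V$ into $p$ pairwise disjoint parts whose union is $V$, and an integer $k$, decide whether there is a selection $S$ of $\mathcal{V}$ (a set $S\subseteq V$ with $|S\cap V_i|=1$ for every $i$) such that $\chi(G[S])\le k$. *)

theory Defs
  imports
    "HOL-Library.FuncSet"
    "HOL-Library.Disjoint_Sets"
    "HOL-Computational_Algebra.Polynomial"
begin

section \<open>Deterministic multi-tape Turing machines and polynomial time\<close>

datatype direction = Go_Left | Stay | Go_Right

text \<open>
  States and tape symbols are initial segments of the natural numbers. Symbol 0 is the blank,
  1 and 2 represent the input bits; a machine may use further symbols.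
\<close>

record tm =
  num_tapes :: nat
  num_symbols :: nat
  num_states :: nat
  start_state :: nat
  accept_state :: nat
  reject_state :: nat
  transition :: "nat \<Rightarrow> nat list \<Rightarrow> nat \<times> (nat \<times> direction) list"

definition wf_tm :: "tm \<Rightarrow> bool" where
  "wf_tm M \<longleftrightarrow>
     num_tapes M \<ge> 1 \<and> num_symbols M \<ge> 3 \<and>
     start_state M < num_states M \<and>
     accept_state M < num_states M \<and>
     reject_state M < num_states M \<and>
     accept_state M \<noteq> reject_state M \<and>
     (\<forall>q < num_states M. \<forall>xs. length xs = num_tapes M \<and> set xs \<subseteq> {..<num_symbols M} \<longrightarrow>
        fst (transition M q xs) < num_states M \<and>
        length (snd (transition M q xs)) = num_tapes M \<and>
        (\<forall>(a, d) \<in> set (snd (transition M q xs)). a < num_symbols M))"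

text \<open>A tape is infinite in both directions and is given by its contents and its head position.\<close>

type_synonym tape = "(int \<Rightarrow> nat) \<times> int"
type_synonym config = "nat \<times> tape list"

fun offset :: "direction \<Rightarrow> int" where
  "offset Go_Left = -1"
| "offset Stay = 0"
| "offset Go_Right = 1"

fun read_tape :: "tape \<Rightarrow> nat" where
  "read_tape (t, h) = t h"

fun act_tape :: "nat \<times> direction \<Rightarrow> tape \<Rightarrow> tape" where
  "act_tape (a, d) (t, h) = (t(h := a), h + offset d)"

text \<open>The accepting and the rejecting state are halting: the configuration no longer changes.\<close>

fun tm_step :: "tm \<Rightarrow> config \<Rightarrow> config" where
  "tm_step M (q, ts) =
     (if q = accept_state M \<or> q = reject_state M then (q, ts)
      else (case transition M q (map read_tape ts) of
              (q', acts) \<Rightarrow> (q', map2 act_tape acts ts)))"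

definition input_tape :: "bool list \<Rightarrow> tape" where
  "input_tape w =
     ((\<lambda>i. if 0 \<le> i \<and> i < int (length w) then (if w ! nat i then 2 else 1) else 0), 0)"

definition blank_tape :: tape where
  "blank_tape = ((\<lambda>_. 0), 0)"

definition init_config :: "tm \<Rightarrow> bool list \<Rightarrow> config" where
  "init_config M w = (start_state M, input_tape w # replicate (num_tapes M - 1) blank_tape)"

text \<open>
  Since halting configurations are fixed by \<^const>\<open>tm_step\<close>, looking at the configuration after
  exactly \<open>T n\<close> steps expresses that the machine halts within \<open>T n\<close> steps.
\<close>

definition decides_in_time :: "tm \<Rightarrow> bool list set \<Rightarrow> (nat \<Rightarrow> nat) \<Rightarrow> bool" where
  "decides_in_time M L T \<longleftrightarrow>
     (\<forall>w. fst ((tm_step M ^^ T (length w)) (init_config M w)) =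
            (if w \<in> L then accept_state M else reject_state M))"

definition polynomial_time_decidable :: "bool list set \<Rightarrow> bool" where
  "polynomial_time_decidable L \<longleftrightarrow>
     (\<exists>M (T :: nat poly). wf_tm M \<and> decides_in_time M L (poly T))"


section \<open>Graphs, colorings and selections\<close>

definition simple_graph :: "'a set \<Rightarrow> 'a set set \<Rightarrow> bool" where
  "simple_graph V E \<longleftrightarrow> finite V \<and> (\<forall>e \<in> E. e \<subseteq> V \<and> card e = 2)"

definition induced_edges :: "'a set set \<Rightarrow> 'a set \<Rightarrow> 'a set set" where
  "induced_edges E S = {e \<in> E. e \<subseteq> S}"

definition proper_coloring :: "'a set \<Rightarrow> 'a set set \<Rightarrow> nat \<Rightarrow> ('a \<Rightarrow> nat) \<Rightarrow> bool" where
  "proper_coloring V E c f \<longleftrightarrow> f \<in> V \<rightarrow> {..<c} \<and> (\<forall>u v. {u, v} \<in> E \<longrightarrow> f u \<noteq> f v)"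

definition chromatic_number :: "'a set \<Rightarrow> 'a set set \<Rightarrow> nat" where
  "chromatic_number V E = (LEAST c. \<exists>f. proper_coloring V E c f)"

definition selection :: "'a set \<Rightarrow> 'a set set \<Rightarrow> 'a set \<Rightarrow> bool" where
  "selection V P S \<longleftrightarrow> S \<subseteq> V \<and> (\<forall>U \<in> P. card (S \<inter> U) = 1)"


section \<open>The Partition Coloring Problem\<close>

text \<open>As usual for problems on finite graphs, the vertices of an instance are numbered.\<close>

record pcp =
  num_vertices :: nat
  edges :: "nat set set"
  parts :: "nat set list"
  color_bound :: int

abbreviation vertices :: "pcp \<Rightarrow> nat set" where
  "vertices I \<equiv> {..<num_vertices I}"

definition pcp_instance :: "pcp \<Rightarrow> bool" where
  "pcp_instance I \<longleftrightarrow>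
     simple_graph (vertices I) (edges I) \<and>
     distinct (parts I) \<and> partition_on (vertices I) (set (parts I))"

definition pcp_yes :: "pcp \<Rightarrow> bool" where
  "pcp_yes I \<longleftrightarrow>
     (\<exists>S. selection (vertices I) (set (parts I)) S \<and>
          int (chromatic_number S (induced_edges (edges I) S)) \<le> color_bound I)"

text \<open>Binary representation, most significant bit first, without leading zeros.\<close>

fun binary :: "nat \<Rightarrow> bool list" where
  "binary n = (if n = 0 then [] else binary (n div 2) @ [odd n])"

declare binary.simps [simp del]

text \<open>
  The encoding consists of the number of vertices and the number of parts (both in unary, each
  terminated by a 0), the upper triangle of the adjacency matrix (column by column), the
  characteristic vectors of the parts, and the bound (a sign bit and its absolute value in binary).
\<close>

definition encode :: "pcp \<Rightarrow> bool list" where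
  "encode I =
     replicate (num_vertices I) True @ [False] @
     replicate (length (parts I)) True @ [False] @
     concat (map (\<lambda>j. map (\<lambda>i. {i, j} \<in> edges I) [0..<j]) [0..<num_vertices I]) @
     concat (map (\<lambda>U. map (\<lambda>v. v \<in> U) [0..<num_vertices I]) (parts I)) @
     (color_bound I < 0) # binary (nat \<bar>color_bound I\<bar>)"

text \<open>Distinct instances have distinct codes, so a code determines the answer.\<close>

lemma unary_inj:
  assumes "replicate m True @ False # xs = replicate n True @ False # ys"
  shows "m = n \<and> xs = ys"
  using assms
proof (induction m arbitrary: n)
  case 0
  then show ?case by (cases n) auto
next
  case (Suc m)
  then show ?case by (cases n) auto
qed

lemma concat_map_inj:
  assumes "concat (map f xs) @ zs = concat (map g ys) @ zs'"
    and "length xs = length ys"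
    and "\<And>x y. (x, y) \<in> set (zip xs ys) \<Longrightarrow> length (f x) = length (g y)"
  shows "map f xs = map g ys \<and> zs = zs'"
  using assms(2,1,3)
proof (induction xs ys rule: list_induct2)
  case Nil
  then show ?case by simp
next
  case (Cons x xs y ys)
  have "length (f x) = length (g y)" using Cons.prems(2) by simp
  with Cons.prems(1) have "f x = g y" "concat (map f xs) @ zs = concat (map g ys) @ zs'"
    by auto
  with Cons.IH Cons.prems(2) show ?case by simp
qed

lemma binary_inj: "binary m = binary n \<Longrightarrow> m = n"
proof (induction m arbitrary: n rule: less_induct)
  case (less m)
  show ?case
  proof (cases "m = 0 \<or> n = 0")
    case True
    with less.prems show ?thesis
      by (simp add: binary.simps[of m] binary.simps[of n] split: if_splits)
  next
    case False
    then have "binary m = binary (m div 2) @ [odd m]" "binary n = binary (n div 2) @ [odd n]"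
      by (simp_all add: binary.simps[of m] binary.simps[of n])
    with less.prems have "binary (m div 2) = binary (n div 2)" and parity: "odd m = odd n"
      by simp_all
    have "m div 2 < m" using False by simp
    then have "m div 2 = n div 2" using less.IH \<open>binary (m div 2) = binary (n div 2)\<close> by blast
    with parity show ?thesis by presburger
  qed
qed

lemma simple_graph_edges_eq:
  fixes n :: nat
  assumes "simple_graph {..<n} E" and "simple_graph {..<n} E'"
    and "\<And>i j. i < j \<Longrightarrow> j < n \<Longrightarrow> {i, j} \<in> E \<longleftrightarrow> {i, j} \<in> E'"
  shows "E = E'"
proof -
  have "e \<in> E \<longleftrightarrow> e \<in> E'" if e: "e \<subseteq> {..<n}" "card e = 2" for e
  proof -
    from e(2) obtain a b where "e = {a, b}" "a \<noteq> b" by (auto simp: card_2_iff)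
    then have "e = {min a b, max a b}" "min a b < max a b" by (auto simp: min_def max_def)
    then obtain i j where "e = {i, j}" "i < j" by blast
    with e(1) assms(3) show ?thesis by auto
  qed
  with assms(1,2) show ?thesis unfolding simple_graph_def by blast
qed

lemma encode_inj: "inj_on encode {I. pcp_instance I}"
proof (rule inj_onI)
  fix I J :: pcp
  assume "I \<in> {I. pcp_instance I}" "J \<in> {I. pcp_instance I}" and eq: "encode I = encode J"
  then have I: "pcp_instance I" and J: "pcp_instance J" by simp_all
  let ?n = "num_vertices I"
  let ?A = "\<lambda>E j. map (\<lambda>i. {i, j} \<in> E) [0..<j]"
  let ?B = "\<lambda>U. map (\<lambda>v. v \<in> U) [0..<?n]"
  note eq' = eq[unfolded encode_def append_Cons append_Nil]
  have n: "num_vertices J = ?n" using unary_inj[OF eq'] by simp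
  note eq'' = conjunct2[OF unary_inj[OF eq']]
  have l: "length (parts I) = length (parts J)" using unary_inj[OF eq''] by simp
  note rest = conjunct2[OF unary_inj[OF eq''], unfolded n]
  have "length (?A (edges I) x) = length (?A (edges J) y)"
    if "(x, y) \<in> set (zip [0..<?n] [0..<?n])" for x y
    using that by (auto simp: set_zip)
  note split1 = concat_map_inj[OF rest refl this]
  note split2 = concat_map_inj[OF conjunct2[OF split1] l]
  have adj: "map (?A (edges I)) [0..<?n] = map (?A (edges J)) [0..<?n]"
    using split1 by blast
  have inc: "map ?B (parts I) = map ?B (parts J)"
    using split2 by simp
  have sgn: "(color_bound I < 0) = (color_bound J < 0)"
    and bin: "binary (nat \<bar>color_bound I\<bar>) = binary (nat \<bar>color_bound J\<bar>)"
    using split2 by simp_all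
  have "edges I = edges J"
  proof (rule simple_graph_edges_eq)
    show "simple_graph {..<?n} (edges I)" "simple_graph {..<?n} (edges J)"
      using I J n by (simp_all add: pcp_instance_def)
    show "{i, j} \<in> edges I \<longleftrightarrow> {i, j} \<in> edges J" if "i < j" "j < ?n" for i j
      using arg_cong[OF adj, of "\<lambda>xs. xs ! j ! i"] that by simp
  qed
  moreover have "parts I = parts J"
  proof (rule nth_equalityI[OF l])
    fix i assume i: "i < length (parts I)"
    then have "parts I ! i \<in> set (parts I)" "parts J ! i \<in> set (parts J)"
      using l by simp_all
    moreover have "\<Union> (set (parts I)) = {..<?n}" "\<Union> (set (parts J)) = {..<?n}"
      using I J n by (simp_all add: pcp_instance_def partition_on_def)
    ultimately have "parts I ! i \<subseteq> {..<?n}" "parts J ! i \<subseteq> {..<?n}" by blast+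
    moreover have "v \<in> parts I ! i \<longleftrightarrow> v \<in> parts J ! i" if "v < ?n" for v
      using arg_cong[OF inc, of "\<lambda>xs. xs ! i ! v"] i l that by simp
    ultimately show "parts I ! i = parts J ! i" by blast
  qed
  moreover have "color_bound I = color_bound J" using sgn binary_inj[OF bin] by linarith
  ultimately show "I = J" using n by simp
qed

end

theory Submission
  imports Defs
begin

text \<open>
  For constant \<open>p\<close> the problem is first-order expressible over the input word, with the position
  arithmetic of the encoding: a solution is given by \<open>p\<close> vertices and one of the finitely many maps
  from the \<open>p\<close> parts to \<open>p\<close> colors, and the bound matters only if it is one of the finitely many
  numbers below \<open>p\<close>. Quantifiers over positions are evaluated by programs whose registers are
  pointers into the input. Since registers saturate at the end of the input and loops run down a
  register, every such program takes polynomial time, and a Turing machine simulates it with one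
  copy of the input per register, the register being the head position.
\<close>

section \<open>Pointer programs\<close>

text \<open>Saturation is sound because of how terms are used. A term only addresses a cell, and
  every cell behind the input is blank, so a truncated address reads the same symbol as the true
  one. Order comparisons, which truncation could falsify, are made only between variables, and these
  range over positions of the input. The bound, written in binary, can be exponentially large and
  fits into no register; it is therefore never decoded but compared as a bit string with the
  numerals below \<open>p\<close>. A machine receives arbitrary words and not only codes, so being a
  code is part of the formula, and even the number of vertices enters as a quantified
  position.\<close>

datatype com =
    Skip
  | Inc nat
  | Dec nat
  | Fill nat
  | Seq com com
  | Cond nat "nat set" com com
  | Loop nat com

type_synonym store = "nat \<Rightarrow> nat"

text \<open>Models a tape with the end marker 3 in cell 0 and input bit \<open>i\<close> in cell
  \<open>i + 1\<close>. A head sees only its own cell, so the marker makes "register is zero"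
  visible and the blank makes "register is saturated" visible.\<close>

definition symbol_at :: "bool list \<Rightarrow> nat \<Rightarrow> nat" where
  "symbol_at w v = (if v = 0 then 3 else if v \<le> length w then (if w ! (v - 1) then 2 else 1) else 0)"

definition bounded_store :: "bool list \<Rightarrow> store \<Rightarrow> bool" where
  "bounded_store w s \<longleftrightarrow> (\<forall>r. s r \<le> Suc (length w))"

text \<open>A loop lowers its register before each round: if the body preserves the register, the
  rounds see the values \<open>s r - 1\<close>, ..., 0.\<close>

fun exec :: "bool list \<Rightarrow> com \<Rightarrow> store \<Rightarrow> store" where
  "exec w Skip s = s"
| "exec w (Inc r) s = s(r := min (Suc (s r)) (Suc (length w)))"
| "exec w (Dec r) s = s(r := s r - 1)"
| "exec w (Fill r) s = s(r := Suc (length w))"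
| "exec w (Seq c d) s = exec w d (exec w c s)"
| "exec w (Cond r A c d) s = (if symbol_at w (s r) \<in> A then exec w c s else exec w d s)"
| "exec w (Loop r c) s = ((\<lambda>s. exec w c (s(r := s r - 1))) ^^ s r) s"

text \<open>The bodies of loops have to leave the loop register alone; otherwise the clause for
  \<^const>\<open>Loop\<close> above does not describe the loop ``while \<open>r \<noteq> 0\<close>''.\<close>

fun valid :: "com \<Rightarrow> bool" where
  "valid (Seq c d) = (valid c \<and> valid d)"
| "valid (Cond r A c d) = (valid c \<and> valid d)"
| "valid (Loop r c) = (valid c \<and> (\<forall>w s. bounded_store w s \<longrightarrow> exec w c s r = s r))"
| "valid _ = True"

lemma funpow_invariant:
  assumes "P 0 x" and "\<And>i y. i < n \<Longrightarrow> P i y \<Longrightarrow> P (Suc i) (f y)"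
  shows "P n ((f ^^ n) x)"
  using assms by (induction n) auto

lemma bounded_store_upd:
  "bounded_store w s \<Longrightarrow> v \<le> Suc (length w) \<Longrightarrow> bounded_store w (s(r := v))"
  by (simp add: bounded_store_def)

lemma bounded_store_dec: "bounded_store w s \<Longrightarrow> bounded_store w (s(r := s r - Suc 0))"
  by (simp add: bounded_store_def le_diff_conv le_SucI)

lemma bounded_store_exec: "bounded_store w s \<Longrightarrow> bounded_store w (exec w c s)"
proof (induction c arbitrary: s)
  case (Dec r)
  then show ?case unfolding exec.simps One_nat_def by (rule bounded_store_dec)
next
  case (Loop r c)
  show ?case unfolding exec.simps
    by (rule funpow_invariant[where P = "\<lambda>_. bounded_store w"])
      (use Loop bounded_store_dec in auto)
qed (auto simp: bounded_store_upd)

text \<open>The invariant is indexed by the counter, which runs downwards. Since the decrement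
  precedes the body, the store \<open>t\<close> entering the body is the previous store with
  \<open>r\<close> lowered by one; raising \<open>r\<close> again recovers the store for which the
  invariant was known.\<close>

lemma exec_Loop_invariant:
  assumes valid: "valid (Loop r c)" and bounded: "bounded_store w s"
    and base: "P (s r) s"
    and step: "\<And>i t. bounded_store w t \<Longrightarrow> t r = i \<Longrightarrow> i < s r \<Longrightarrow> P (Suc i) (t(r := Suc i)) \<Longrightarrow>
       P i (exec w c t)"
  shows "P 0 (exec w (Loop r c) s) \<and> exec w (Loop r c) s r = 0"
proof -
  let ?f = "\<lambda>s. exec w c (s(r := s r - 1))"
  have "bounded_store w ((?f ^^ s r) s) \<and> (?f ^^ s r) s r = s r - s r \<and> P (s r - s r) ((?f ^^ s r) s)"
  proof (rule funpow_invariant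
      [where P = "\<lambda>i t. bounded_store w t \<and> t r = s r - i \<and> P (s r - i) t"])
    show "bounded_store w s \<and> s r = s r - 0 \<and> P (s r - 0) s" using assms by simp
  next
    fix i t
    assume i: "i < s r" and t: "bounded_store w t \<and> t r = s r - i \<and> P (s r - i) t"
    let ?t = "t(r := t r - 1)"
    have b: "bounded_store w ?t"
      using bounded_store_dec[OF conjunct1[OF t], of r] by (simp only: One_nat_def)
    have r: "?t r = s r - Suc i" using t by simp
    have "?t(r := Suc (s r - Suc i)) = t" using t i by (auto simp: Suc_diff_Suc)
    then have "P (Suc (s r - Suc i)) (?t(r := Suc (s r - Suc i)))"
      using t i by (simp add: Suc_diff_Suc)
    then have "P (s r - Suc i) (exec w c ?t)" using step[of ?t, OF b r] i by auto
    then show "bounded_store w (?f t) \<and> ?f t r = s r - Suc i \<and> P (s r - Suc i) (?f t)"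
      using valid b r bounded_store_exec by auto
  qed
  then show ?thesis by simp
qed

section \<open>Small-step execution with continuations\<close>

text \<open>The next continuation and the head movements depend on the stores only through the
  symbols \<open>g\<close> under the heads. This is what lets \<open>ctrl\<close> become a
  transition function.\<close>

fun ctrl :: "com list \<Rightarrow> (nat \<Rightarrow> nat) \<Rightarrow> com list \<times> (nat \<Rightarrow> direction)" where
  "ctrl [] g = ([], \<lambda>_. Stay)"
| "ctrl (Skip # K) g = (K, \<lambda>_. Stay)"
| "ctrl (Inc r # K) g = (K, (\<lambda>_. Stay)(r := if g r = 0 then Stay else Go_Right))"
| "ctrl (Dec r # K) g = (K, (\<lambda>_. Stay)(r := if g r = 3 then Stay else Go_Left))"
| "ctrl (Fill r # K) g =
     (if g r = 0 then (K, \<lambda>_. Stay) else (Fill r # K, (\<lambda>_. Stay)(r := Go_Right)))"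
| "ctrl (Seq c d # K) g = (c # d # K, \<lambda>_. Stay)"
| "ctrl (Cond r A c d # K) g = ((if g r \<in> A then c else d) # K, \<lambda>_. Stay)"
| "ctrl (Loop r c # K) g =
     (if g r = 3 then (K, \<lambda>_. Stay) else (c # Loop r c # K, (\<lambda>_. Stay)(r := Go_Left)))"

fun move :: "direction \<Rightarrow> nat \<Rightarrow> nat" where
  "move Go_Left v = v - 1"
| "move Stay v = v"
| "move Go_Right v = Suc v"

fun cstep :: "bool list \<Rightarrow> com list \<times> store \<Rightarrow> com list \<times> store" where
  "cstep w (K, s) =
     (case ctrl K (\<lambda>r. symbol_at w (s r)) of (K', d) \<Rightarrow> (K', \<lambda>r. move (d r) (s r)))"

lemma symbol_at_eq_3_iff [simp]: "symbol_at w v = 3 \<longleftrightarrow> v = 0"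
  by (simp add: symbol_at_def)

lemma symbol_at_eq_0_iff [simp]: "symbol_at w v = 0 \<longleftrightarrow> v > length w"
  by (auto simp: symbol_at_def)

text \<open>A register can move right at most \<open>length w + 1\<close> times, and one more step
  notices the blank; this gives \<open>[:2, 1:]\<close>. A loop has at most
  \<open>length w + 1\<close> rounds, each a test followed by the body, and one final test. Nesting
  of loops thus only multiplies polynomials.\<close>

fun time_bound :: "com \<Rightarrow> nat poly" where
  "time_bound (Fill r) = [:2, 1:]"
| "time_bound (Seq c d) = time_bound c + time_bound d + 1"
| "time_bound (Cond r A c d) = time_bound c + time_bound d + 1"
| "time_bound (Loop r c) = [:1, 1:] * (time_bound c + 1) + 1"
| "time_bound _ = 1"

lemma csteps_trans:
  assumes "(cstep w ^^ t) x = y" and "(cstep w ^^ u) y = z"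
  shows "(cstep w ^^ (u + t)) x = z"
  using assms by (simp add: funpow_add)

lemma csteps_Fill:
  "s r + n = Suc (length w) \<Longrightarrow>
   (cstep w ^^ Suc n) (Fill r # K, s) = (K, s(r := Suc (length w)))"
proof (induction n arbitrary: s)
  case 0
  then show ?case by (auto simp: fun_eq_iff)
next
  case (Suc n)
  have step: "cstep w (Fill r # K, s) = (Fill r # K, s(r := Suc (s r)))"
    using Suc.prems by (auto simp: fun_eq_iff)
  have "(s(r := Suc (s r))) r + n = Suc (length w)" using Suc.prems by simp
  from Suc.IH[of "s(r := Suc (s r))", OF this] show ?case
    unfolding funpow_Suc_right[of "Suc n"] o_def step fun_upd_upd .
qed

text \<open>Induction on the program for all continuations \<open>K\<close> at once: the body of a
  loop is executed in front of that same loop.\<close>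

lemma csteps_exec:
  assumes "valid c" and "bounded_store w s"
  shows "\<exists>t \<le> poly (time_bound c) (length w). (cstep w ^^ t) (c # K, s) = (K, exec w c s)"
  using assms
proof (induction c arbitrary: s K)
  case Skip
  show ?case by (rule exI[of _ 1]) simp
next
  case (Inc r)
  then have "s r \<le> Suc (length w)" by (simp add: bounded_store_def)
  then show ?case by (intro exI[of _ 1]) (auto simp: fun_eq_iff)
next
  case (Dec r)
  show ?case by (rule exI[of _ 1]) (auto simp: fun_eq_iff)
next
  case (Fill r)
  then have "s r \<le> Suc (length w)" by (simp add: bounded_store_def)
  then have "s r + (Suc (length w) - s r) = Suc (length w)" by simp
  from csteps_Fill[of s r, OF this, of K] show ?case
    by (intro exI[of _ "Suc (Suc (length w) - s r)"]) (auto simp: fun_eq_iff simp del: funpow.simps)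
next
  case (Seq c d)
  from Seq.IH(1)[OF _ Seq.prems(2), of "d # K"] Seq.prems obtain t where
    t: "t \<le> poly (time_bound c) (length w)"
      "(cstep w ^^ t) (c # d # K, s) = (d # K, exec w c s)" by auto
  from Seq.IH(2)[OF _ bounded_store_exec[OF Seq.prems(2)], of K] Seq.prems obtain u where
    u: "u \<le> poly (time_bound d) (length w)"
      "(cstep w ^^ u) (d # K, exec w c s) = (K, exec w d (exec w c s))" by auto
  have "(cstep w ^^ (u + t + 1)) (Seq c d # K, s) = (K, exec w (Seq c d) s)"
    using csteps_trans[OF t(2) u(2)] by (simp add: funpow_Suc_right del: funpow.simps)
  then show ?case using t(1) u(1) by (intro exI[of _ "u + t + 1"]) simp
next
  case (Cond r A c d)
  let ?c = "if symbol_at w (s r) \<in> A then c else d"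
  have "\<exists>t \<le> poly (time_bound ?c) (length w).
      (cstep w ^^ t) (?c # K, s) = (K, exec w (Cond r A c d) s)"
    using Cond by auto
  then obtain t where
    t: "t \<le> poly (time_bound ?c) (length w)"
      "(cstep w ^^ t) (?c # K, s) = (K, exec w (Cond r A c d) s)" by blast
  have "cstep w (Cond r A c d # K, s) = (?c # K, s)" by simp
  then have "(cstep w ^^ Suc t) (Cond r A c d # K, s) = (K, exec w (Cond r A c d) s)"
    unfolding funpow_Suc_right o_def using t(2) by simp
  moreover have "Suc t \<le> poly (time_bound (Cond r A c d)) (length w)"
    using t(1) by (auto split: if_splits)
  ultimately show ?case by blast
next
  case (Loop r c)
  let ?f = "\<lambda>s. exec w c (s(r := s r - 1))"
  let ?B = "poly (time_bound c) (length w)"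
  have "\<exists>t \<le> n * (?B + 1) + 1. (cstep w ^^ t) (Loop r c # K, s) = (K, (?f ^^ n) s)"
    if "s r = n" "bounded_store w s" for n s
    using that
  proof (induction n arbitrary: s)
    case 0
    then show ?case by (intro exI[of _ 1]) simp
  next
    case (Suc n)
    let ?s = "s(r := s r - 1)"
    have b: "bounded_store w ?s" using Suc.prems(2) bounded_store_dec by simp
    have "valid c" using Loop.prems(1) by simp
    from Loop.IH[OF this b, of "Loop r c # K"] obtain t where
      t: "t \<le> ?B" "(cstep w ^^ t) (c # Loop r c # K, ?s) = (Loop r c # K, ?f s)" by blast
    \<comment> \<open>Validity of the loop enters here: the body leaves \<open>r\<close> alone, so
      exactly \<open>n\<close> rounds remain.\<close>
    have "?f s r = n" using Loop.prems(1) b Suc.prems(1) by simp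
    from Suc.IH[OF this bounded_store_exec[OF b]] obtain u where
      u: "u \<le> n * (?B + 1) + 1"
        "(cstep w ^^ u) (Loop r c # K, ?f s) = (K, (?f ^^ n) (?f s))" by blast
    have step: "cstep w (Loop r c # K, s) = (c # Loop r c # K, ?s)"
      using Suc.prems(1) by (auto simp: fun_eq_iff)
    have "(cstep w ^^ Suc (u + t)) (Loop r c # K, s) = (K, (?f ^^ n) (?f s))"
      unfolding funpow_Suc_right o_def step by (rule csteps_trans[OF t(2) u(2)])
    then have "(cstep w ^^ Suc (u + t)) (Loop r c # K, s) = (K, (?f ^^ Suc n) s)"
      by (simp add: funpow_Suc_right del: funpow.simps)
    moreover have "Suc (u + t) \<le> Suc n * (?B + 1) + 1" using t(1) u(1) by simp
    ultimately show ?case by blast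
  qed
  from this[OF refl Loop.prems(2)] obtain t where
    t: "t \<le> s r * (?B + 1) + 1" "(cstep w ^^ t) (Loop r c # K, s) = (K, (?f ^^ s r) s)"
    by blast
  have "s r * (?B + 1) \<le> Suc (length w) * (?B + 1)"
    using Loop.prems(2) unfolding bounded_store_def by (intro mult_right_mono) auto
  then have "t \<le> poly (time_bound (Loop r c)) (length w)" using t(1) by (simp add: algebra_simps)
  then show ?case using t(2) by auto
qed

text \<open>The continuations that occur while \<open>c\<close> is executed in front of \<open>K\<close>; there are finitely many,
  so they can serve as the states of a Turing machine.\<close>

fun conts :: "com \<Rightarrow> com list \<Rightarrow> com list set" where
  "conts (Seq c d) K = insert (Seq c d # K) (conts c (d # K) \<union> conts d K)"
| "conts (Cond r A c d) K = insert (Cond r A c d # K) (conts c K \<union> conts d K)"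
| "conts (Loop r c) K = insert (Loop r c # K) (conts c (Loop r c # K))"
| "conts c K = {c # K}"

lemma finite_conts: "finite (conts c K)"
  by (induction c arbitrary: K) auto

lemma Cons_in_conts: "c # K \<in> conts c K"
  by (cases c) auto

lemma ctrl_in_conts:
  "L \<in> conts c K \<Longrightarrow> fst (ctrl L g) \<in> insert K (conts c K)"
proof (induction c arbitrary: K)
  case (Seq c d)
  show ?case
    using Seq.prems Seq.IH(1)[of "d # K"] Seq.IH(2)[of K] Cons_in_conts[of c "d # K"]
      Cons_in_conts[of d K] by auto
next
  case (Cond r A c d)
  show ?case
    using Cond.prems Cond.IH(1)[of K] Cond.IH(2)[of K] Cons_in_conts[of c K]
      Cons_in_conts[of d K] by auto
next
  case (Loop r c)
  show ?case
    using Loop.prems Loop.IH[of "Loop r c # K"] Cons_in_conts[of c "Loop r c # K"]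
    by (auto split: if_splits)
qed auto

fun regs :: "com \<Rightarrow> nat set" where
  "regs Skip = {}"
| "regs (Inc r) = {r}"
| "regs (Dec r) = {r}"
| "regs (Fill r) = {r}"
| "regs (Seq c d) = regs c \<union> regs d"
| "regs (Cond r A c d) = insert r (regs c \<union> regs d)"
| "regs (Loop r c) = insert r (regs c)"

lemma finite_regs: "finite (regs c)"
  by (induction c) auto

lemma regs_conts:
  "L \<in> conts c K \<Longrightarrow> d \<in> set L \<Longrightarrow> regs d \<subseteq> regs c \<union> \<Union> (regs ` set K)"
proof (induction c arbitrary: K)
  case (Seq c1 c2)
  show ?case using Seq.prems Seq.IH(1)[of "c2 # K"] Seq.IH(2)[of K] by auto
next
  case (Cond r A c1 c2)
  show ?case using Cond.prems Cond.IH(1)[of K] Cond.IH(2)[of K] by auto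
next
  case (Loop r c)
  show ?case using Loop.prems Loop.IH[of "Loop r c # K"] by auto
qed auto

text \<open>The machine has only \<open>k\<close> register tapes, so its list of read symbols agrees
  with \<open>symbol_at\<close> only on registers below \<open>k\<close>. These are the only ones
  that a continuation inspects.\<close>

lemma ctrl_cong:
  assumes "\<And>c r. c \<in> set K \<Longrightarrow> r \<in> regs c \<Longrightarrow> g r = h r"
  shows "ctrl K g = ctrl K h"
proof (cases K)
  case (Cons c L)
  then show ?thesis using assms[of c] by (cases c) auto
qed simp

text \<open>Heads never leave cell 0 to the left. There the register operation \<open>move\<close>
  would stay at 0 while a real head would go to cell -1.\<close>

lemma ctrl_Go_Left: "snd (ctrl K g) r = Go_Left \<Longrightarrow> g r \<noteq> 3"
  by (cases "(K, g)" rule: ctrl.cases) (auto split: if_splits)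

section \<open>Simulation by a Turing machine\<close>

lemma funpow_one: "(f ^^ 1) x = f x" for f :: "'a \<Rightarrow> 'a"
  by simp

lemma map2_map: "map2 f (map g xs) (map h xs) = map (\<lambda>x. f (g x) (h x)) xs"
  by (induction xs) auto

lemma tm_steps_halted:
  "q = accept_state M \<or> q = reject_state M \<Longrightarrow> (tm_step M ^^ n) (q, ts) = (q, ts)"
  by (induction n) auto

text \<open>Any numbering of the continuations will do as long as the states below 5 stay free.
  Every number from 5 up to \<open>m\<close> has to decode to a continuation, since well-formedness
  constrains the transitions of all states. A register tape must exist because tape 1 signals the
  end of rewinding and carries the result.\<close>

locale program_machine =
  fixes c :: com and k :: nat and code :: "com list \<Rightarrow> nat" and decode :: "nat \<Rightarrow> com list"
    and m :: nat
  assumes valid: "valid c"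
    and regs: "regs c \<subseteq> {..<k}"
    and k_pos: "k > 0"
    and code: "L \<in> insert [] (conts c []) \<Longrightarrow> 5 \<le> code L \<and> code L < m \<and> decode (code L) = L"
    and decode: "5 \<le> q \<Longrightarrow> q < m \<Longrightarrow> decode q \<in> insert [] (conts c [])"
begin

abbreviation states :: "com list set" where
  "states \<equiv> insert [] (conts c [])"

text \<open>State 0 writes end markers 3 on the tapes, state 1 copies the input, state 2 rewinds,
  3 and 4 halt, and the states from 5 on stand for continuations. The registers are the head
  positions on tapes \<open>1, ..., k\<close>.\<close>

definition delta :: "nat \<Rightarrow> nat list \<Rightarrow> nat \<times> (nat \<times> direction) list" where
  "delta q xs =
    (if q = 0 then (1, (hd xs, Stay) # replicate k (3, Go_Right))
     else if q = 1 then
       (if hd xs = 0 then (2, (0, Stay) # replicate k (0, Stay))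
        else (1, (hd xs, Go_Right) # replicate k (hd xs, Go_Right)))
     else if q = 2 then
       (if xs ! 1 = 3 then (code [c], map (\<lambda>x. (x, Stay)) xs)
        else (2, (hd xs, Stay) # map (\<lambda>x. (x, Go_Left)) (tl xs)))
     else if decode q = [] then
       (if xs ! 1 = 3 then 4 else 3, map (\<lambda>x. (x, Stay)) xs)
     else (case ctrl (decode q) (\<lambda>r. xs ! Suc r) of (K, d) \<Rightarrow>
       (code K, (hd xs, Stay) # map (\<lambda>r. (xs ! Suc r, d r)) [0..<k])))"

definition machine :: tm where
  "machine = \<lparr>num_tapes = Suc k, num_symbols = 4, num_states = m, start_state = 0,
     accept_state = 3, reject_state = 4,
     transition = (\<lambda>q xs. if q = 3 \<or> q = 4 then (q, map (\<lambda>x. (x, Stay)) xs) else delta q xs)\<rparr>"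

lemma ctrl_in_states: "L \<in> states \<Longrightarrow> fst (ctrl L g) \<in> states"
  using ctrl_in_conts[of L c "[]" g] by auto

lemma machine_wf: "wf_tm machine"
proof -
  have m: "5 < m" using code[of "[]"] code[of "[c]"] Cons_in_conts[of c "[]"]
    by (metis insertCI le_neq_implies_less le_less_trans list.distinct(1))
  have c: "code [c] < m" using code Cons_in_conts by simp
  have "fst (delta q xs) < m \<and> length (snd (delta q xs)) = Suc k \<and>
      (\<forall>(a, d) \<in> set (snd (delta q xs)). a < 4)"
    if q: "q < m" "q \<noteq> 3" "q \<noteq> 4" and xs: "length xs = Suc k" "set xs \<subseteq> {..<4}" for q xs
  proof -
    have nth: "xs ! i < 4" if "i < Suc k" for i using xs that nth_mem[of i xs] by force
    obtain y ys where xs': "xs = y # ys" using xs(1) by (cases xs) auto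
    have y: "y < 4" using xs(2) xs' by simp
    have ys: "\<And>z. z \<in> set ys \<Longrightarrow> z < 4" and len: "length ys = k" using xs xs' by auto
    consider "q < 3" | "decode q = []" "5 \<le> q" | "decode q \<noteq> []" "5 \<le> q"
      using q by linarith
    then show ?thesis
    proof cases
      case 1
      then have "q = 0 \<or> q = 1 \<or> q = 2" by linarith
      then show ?thesis
        using y ys len m c by (auto simp: delta_def xs' split: if_splits)
    next
      case 2
      then show ?thesis using y ys len m by (auto simp: delta_def xs')
    next
      case 3
      obtain K d where K: "ctrl (decode q) (\<lambda>r. xs ! Suc r) = (K, d)" by fastforce
      have "K \<in> states"
        using ctrl_in_states[OF decode[OF 3(2) q(1)], of "\<lambda>r. xs ! Suc r"] K by simp
      then have "code K < m" using code by blast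
      then show ?thesis using 3 K nth[of "Suc _"] y by (auto simp: delta_def xs')
    qed
  qed
  then show ?thesis
    using m by (fastforce simp: wf_tm_def machine_def)
qed

section \<open>Simulation of control steps on tapes\<close>

definition tape_of :: "bool list \<Rightarrow> int \<Rightarrow> nat" where
  "tape_of w = (\<lambda>i. if i < 0 then 0 else symbol_at w (nat i))"

text \<open>The head on the input tape stays parked on the blank behind the input, where copying
  ends. Hence tape 0 contributes the constant symbol 0 from then on.\<close>

definition tapes :: "bool list \<Rightarrow> store \<Rightarrow> tape list" where
  "tapes w s = (fst (input_tape w), int (length w)) # map (\<lambda>r. (tape_of w, int (s r))) [0..<k]"

lemma read_tapes:
  "map read_tape (tapes w s) = 0 # map (\<lambda>r. symbol_at w (s r)) [0..<k]"
  by (simp add: tapes_def input_tape_def tape_of_def)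

lemma act_tapes:
  assumes "\<And>r. r < k \<Longrightarrow> d r = Go_Left \<Longrightarrow> s r > 0"
  shows "map2 act_tape ((0, Stay) # map (\<lambda>r. (symbol_at w (s r), d r)) [0..<k]) (tapes w s) =
     tapes w (\<lambda>r. move (d r) (s r))"
proof -
  have "act_tape (symbol_at w (s r), d r) (tape_of w, int (s r)) = (tape_of w, int (move (d r) (s r)))"
    if "r < k" for r
    using assms[OF that] by (cases "d r") (auto simp: tape_of_def fun_eq_iff)
  then show ?thesis
    by (auto simp: tapes_def map2_map input_tape_def fun_eq_iff)
qed

lemma machine_step:
  assumes "K \<in> states" and "K \<noteq> []" and K': "cstep w (K, s) = (K', s')"
  shows "tm_step machine (code K, tapes w s) = (code K', tapes w s') \<and> K' \<in> states"
proof -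
  have q: "5 \<le> code K" "decode (code K) = K" using code assms(1) by auto
  let ?xs = "map read_tape (tapes w s)"
  have K_regs: "\<And>d. d \<in> set K \<Longrightarrow> regs d \<subseteq> {..<k}"
    using regs_conts[of K c "[]"] regs assms(1) by auto
  have cong: "ctrl K (\<lambda>r. ?xs ! Suc r) = ctrl K (\<lambda>r. symbol_at w (s r))"
    by (rule ctrl_cong) (use K_regs in \<open>force simp: read_tapes\<close>)
  obtain d where d: "ctrl K (\<lambda>r. symbol_at w (s r)) = (K', d)" "s' = (\<lambda>r. move (d r) (s r))"
    using K' by (auto split: prod.splits)
  have pos: "s r > 0" if "d r = Go_Left" for r
    using ctrl_Go_Left[of K "\<lambda>r. symbol_at w (s r)" r] d that by auto
  have "delta (code K) ?xs = (code K', (0, Stay) # map (\<lambda>r. (symbol_at w (s r), d r)) [0..<k])"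
    using q assms(2) cong d by (simp add: delta_def) (simp add: read_tapes)
  then have "tm_step machine (code K, tapes w s) = (code K', tapes w s')"
    using q act_tapes[of d s w] pos d(2) by (simp add: machine_def)
  moreover have "K' \<in> states" using ctrl_in_states[OF assms(1)] d by (metis fst_conv)
  ultimately show ?thesis by blast
qed

text \<open>The machine may need fewer steps: \<open>cstep\<close> idles at the empty continuation,
  whereas the machine leaves the corresponding state for a halting one.\<close>

lemma machine_steps:
  assumes "K \<in> states" and "(cstep w ^^ t) (K, s) = ([], s')"
  shows "\<exists>u \<le> t. (tm_step machine ^^ u) (code K, tapes w s) = (code [], tapes w s')"
  using assms
proof (induction t arbitrary: K s)
  case 0
  then show ?case by simp
next
  case (Suc t)
  show ?case
  proof (cases "K = []")
    case True
    have "(cstep w ^^ n) ([], s) = ([], s)" for n by (induction n) auto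
    then show ?thesis using True Suc.prems by (intro exI[of _ 0]) auto
  next
    case False
    obtain K' s'' where K': "cstep w (K, s) = (K', s'')" by fastforce
    note step = machine_step[OF Suc.prems(1) False K']
    have "(cstep w ^^ t) (K', s'') = ([], s')"
      using Suc.prems(2) K' by (simp add: funpow_Suc_right del: funpow.simps)
    from Suc.IH[OF conjunct2[OF step] this] obtain u where
      "u \<le> t" "(tm_step machine ^^ u) (code K', tapes w s'') = (code [], tapes w s')" by blast
    then show ?thesis using step
      by (intro exI[of _ "Suc u"]) (simp add: funpow_Suc_right del: funpow.simps)
  qed
qed

section \<open>Preparing the register tapes and halting\<close>

definition partial_tape :: "bool list \<Rightarrow> nat \<Rightarrow> int \<Rightarrow> nat" where
  "partial_tape w n = (\<lambda>i. if i < 0 \<or> i > int n then 0 else symbol_at w (nat i))"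

lemma machine_start:
  "tm_step machine (init_config machine w) =
     (1, (fst (input_tape w), 0) # replicate k (partial_tape w 0, 1))"
  by (auto simp: init_config_def machine_def delta_def input_tape_def blank_tape_def
      partial_tape_def fun_eq_iff symbol_at_def zip_replicate zip_Cons1)

text \<open>The register heads run one cell ahead of the input head because cell 0 holds the
  marker.\<close>

lemma machine_copy:
  "n \<le> length w \<Longrightarrow>
   (tm_step machine ^^ n) (1, (fst (input_tape w), 0) # replicate k (partial_tape w 0, 1)) =
     (1, (fst (input_tape w), int n) # replicate k (partial_tape w n, 1 + int n))"
proof (induction n)
  case 0
  then show ?case by simp
next
  case (Suc n)
  have "(partial_tape w n)(1 + int n := symbol_at w (Suc n)) = partial_tape w (Suc n)"
    by (auto simp: partial_tape_def fun_eq_iff nat_add_distrib)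
  moreover have "fst (input_tape w) (int n) = symbol_at w (Suc n)" "symbol_at w (Suc n) \<noteq> 0"
    using Suc.prems by (auto simp: input_tape_def symbol_at_def)
  moreover have "(fst (input_tape w))(int n := symbol_at w (Suc n)) = fst (input_tape w)"
    using calculation by (simp add: fun_upd_idem)
  ultimately show ?case using Suc
    by (simp add: machine_def delta_def zip_replicate)
qed

text \<open>All register heads move in lockstep, so the marker on tape 1 announces that every
  register is zero. The last of the \<open>Suc n\<close> steps is the one that notices it.\<close>

lemma machine_rewind:
  "(tm_step machine ^^ Suc n) (2, tapes w (\<lambda>_. n)) = (code [c], tapes w (\<lambda>_. 0))"
proof (induction n)
  case 0
  have "delta 2 (map read_tape (tapes w (\<lambda>_. 0))) =
      (code [c], (0, Stay) # map (\<lambda>r. (symbol_at w 0, Stay)) [0..<k])"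
    using k_pos by (simp add: delta_def read_tapes)
  then show ?case using act_tapes[of "\<lambda>_. Stay" "\<lambda>_. 0" w] by (simp add: machine_def)
next
  case (Suc n)
  have "delta 2 (map read_tape (tapes w (\<lambda>_. Suc n))) =
      (2, (0, Stay) # map (\<lambda>r. (symbol_at w (Suc n), Go_Left)) [0..<k])"
    using k_pos by (simp add: delta_def read_tapes)
  then have step: "tm_step machine (2, tapes w (\<lambda>_. Suc n)) = (2, tapes w (\<lambda>_. n))"
    using act_tapes[of "\<lambda>_. Go_Left" "\<lambda>_. Suc n" w] by (simp add: machine_def)
  show ?case unfolding funpow_Suc_right[of "Suc n"] o_def step by (rule Suc.IH)
qed

lemma machine_halt:
  "tm_step machine (code [], tapes w s) = (if s 0 = 0 then 4 else 3, tapes w s)"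
proof -
  have "5 \<le> code []" "decode (code []) = []" using code by auto
  then have "delta (code []) (map read_tape (tapes w s)) =
      (if s 0 = 0 then 4 else 3, (0, Stay) # map (\<lambda>r. (symbol_at w (s r), Stay)) [0..<k])"
    using k_pos by (simp add: delta_def read_tapes)
  then show ?thesis
    using act_tapes[of "\<lambda>_. Stay" s w] \<open>5 \<le> code []\<close> by (simp add: machine_def)
qed

lemma machine_prepare:
  "\<exists>t \<le> 2 * length w + 4.
     (tm_step machine ^^ t) (init_config machine w) = (code [c], tapes w (\<lambda>_. 0))"
proof -
  let ?n = "length w"
  have tapes_n: "(fst (input_tape w), int ?n) # replicate k (partial_tape w ?n, 1 + int ?n) =
      tapes w (\<lambda>_. Suc ?n)"
    by (auto simp: tapes_def tape_of_def partial_tape_def map_replicate_const fun_eq_iff symbol_at_def)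
  have "delta 1 (map read_tape (tapes w (\<lambda>_. Suc ?n))) =
      (2, (0, Stay) # map (\<lambda>r. (symbol_at w (Suc ?n), Stay)) [0..<k])"
    by (simp add: delta_def read_tapes map_replicate_const symbol_at_def)
  then have turn: "tm_step machine (1, tapes w (\<lambda>_. Suc ?n)) = (2, tapes w (\<lambda>_. Suc ?n))"
    using act_tapes[of "\<lambda>_. Stay" "\<lambda>_. Suc ?n" w] by (simp add: machine_def)
  \<comment> \<open>One step writes the markers, \<open>?n\<close> steps copy, one step turns
    around, and rewinding from cell \<open>?n + 1\<close> takes \<open>?n + 2\<close> steps.\<close>
  have "(tm_step machine ^^ (Suc (Suc ?n) + (1 + (?n + 1)))) (init_config machine w) =
      (code [c], tapes w (\<lambda>_. 0))"
    using machine_rewind[of "Suc ?n" w] turn machine_copy[of ?n w] machine_start[of w] tapes_n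
    by (simp only: funpow_add o_apply funpow_one order_refl simp_thms)
  then show ?thesis by (intro exI[of _ "Suc (Suc ?n) + (1 + (?n + 1))"]) auto
qed

text \<open>The summand \<open>[:5, 2:]\<close> pays for the at most \<open>2 * length w + 4\<close>
  steps of preparation and the final step into a halting state.\<close>

lemma machine_decides:
  "decides_in_time machine {w. exec w c (\<lambda>_. 0) 0 \<noteq> 0} (poly (time_bound c + [:5, 2:]))"
  unfolding decides_in_time_def
proof
  fix w
  let ?s = "exec w c (\<lambda>_. 0)" and ?T = "poly (time_bound c + [:5, 2:]) (length w)"
  let ?q = "if ?s 0 = 0 then 4 else 3 :: nat"
  obtain t where t: "t \<le> 2 * length w + 4"
    "(tm_step machine ^^ t) (init_config machine w) = (code [c], tapes w (\<lambda>_. 0))"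
    using machine_prepare by blast
  have "bounded_store w (\<lambda>_. 0)" by (simp add: bounded_store_def)
  from csteps_exec[OF valid this, of "[]"] obtain u where
    u: "u \<le> poly (time_bound c) (length w)" "(cstep w ^^ u) ([c], \<lambda>_. 0) = ([], ?s)" by blast
  have "[c] \<in> states" using Cons_in_conts by simp
  from machine_steps[OF this u(2)] obtain v where
    v: "v \<le> u" "(tm_step machine ^^ v) (code [c], tapes w (\<lambda>_. 0)) = (code [], tapes w ?s)"
    by blast
  \<comment> \<open>The answer is inspected after exactly \<open>?T\<close> steps; the surplus
    \<open>e\<close> is spent in the halting state.\<close>
  obtain e where e: "?T = e + (1 + (v + t))"
    using t(1) u(1) v(1) le_iff_add[of "1 + (v + t)" ?T] by (auto simp: algebra_simps)
  have "(tm_step machine ^^ ?T) (init_config machine w) = (?q, tapes w ?s)"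
    unfolding e funpow_add o_apply t(2) v(2) funpow_one machine_halt
    by (rule tm_steps_halted) (simp add: machine_def)
  then show "fst ((tm_step machine ^^ ?T) (init_config machine w)) =
      (if w \<in> {w. exec w c (\<lambda>_. 0) 0 \<noteq> 0} then accept_state machine else reject_state machine)"
    by (simp add: machine_def)
qed

end

theorem program_polynomial_time:
  assumes "valid c"
  shows "polynomial_time_decidable {w. exec w c (\<lambda>_. 0) 0 \<noteq> 0}"
proof -
  obtain k where k: "regs c \<subseteq> {..<k}" using finite_nat_bounded[OF finite_regs] by blast
  let ?S = "insert [] (conts c [])"
  have "finite ?S" using finite_conts by simp
  then obtain h where h: "bij_betw h {0..<card ?S} ?S" using ex_bij_betw_nat_finite by blast
  let ?code = "\<lambda>L. 5 + the_inv_into {0..<card ?S} h L" and ?decode = "\<lambda>q. h (q - 5)"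
  \<comment> \<open>\<open>Suc k\<close> instead of \<open>k\<close> guarantees a register tape, and
    the numbering of the continuations is shifted past the five special states.\<close>
  interpret program_machine c "Suc k" ?code ?decode "5 + card ?S"
  proof
    show "valid c" "0 < Suc k" using assms by auto
    show "regs c \<subseteq> {..<Suc k}" using k by auto
    fix L assume "L \<in> ?S"
    then show "5 \<le> ?code L \<and> ?code L < 5 + card ?S \<and> ?decode (?code L) = L"
      using h the_inv_into_into[of h "{0..<card ?S}" L "{0..<card ?S}"]
        f_the_inv_into_f[of h "{0..<card ?S}" L]
      by (auto simp: bij_betw_def)
  next
    fix q assume "5 \<le> q" "q < 5 + card ?S"
    then have "q - 5 \<in> {0..<card ?S}" by auto
    then show "?decode q \<in> ?S" using h unfolding bij_betw_def by blast
  qed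
  show ?thesis
    unfolding polynomial_time_decidable_def using machine_wf machine_decides by blast
qed

section \<open>Computable terms and decidable predicates\<close>

definition clear :: "nat \<Rightarrow> com" where
  "clear r = Loop r Skip"

definition add_to :: "nat \<Rightarrow> nat \<Rightarrow> com" where
  "add_to r b = Loop r (Inc b)"

definition subtract_from :: "nat \<Rightarrow> nat \<Rightarrow> com" where
  "subtract_from r b = Loop r (Dec b)"

text \<open>Loops consume the register that they count, so its value is moved into two registers and
  one of them is moved back.\<close>

definition copy :: "nat \<Rightarrow> nat \<Rightarrow> nat \<Rightarrow> com" where
  "copy r b u = Seq (Seq (clear b) (clear u)) (Seq (Loop r (Seq (Inc b) (Inc u))) (add_to u r))"

lemma valid_programs [simp]:
  "valid (clear r)"
  "r \<noteq> b \<Longrightarrow> valid (add_to r b)"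
  "r \<noteq> b \<Longrightarrow> valid (subtract_from r b)"
  "r \<noteq> b \<Longrightarrow> r \<noteq> u \<Longrightarrow> valid (copy r b u)"
  by (simp_all add: clear_def add_to_def subtract_from_def copy_def)

lemma exec_clear [simp]: "exec w (clear r) s = s(r := 0)"
proof -
  have "((\<lambda>s. s(r := s r - 1)) ^^ n) s = s(r := s r - n)" for n
    by (induction n) (auto simp: fun_eq_iff)
  then show ?thesis by (simp add: clear_def)
qed

lemma exec_add_to:
  assumes "r \<noteq> b" and "bounded_store w s"
  shows "exec w (add_to r b) s = s(r := 0, b := min (s b + s r) (Suc (length w)))"
proof -
  let ?P = "\<lambda>i t. t = s(r := i, b := min (s b + (s r - i)) (Suc (length w)))"
  have "?P 0 (exec w (Loop r (Inc b)) s) \<and> exec w (Loop r (Inc b)) s r = 0"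
  proof (rule exec_Loop_invariant[where P = ?P])
    show "valid (Loop r (Inc b))" using assms by simp
    show "?P (s r) s" using assms by (auto simp: bounded_store_def fun_eq_iff)
  next
    fix i t assume t: "t r = i" "i < s r" "?P (Suc i) (t(r := Suc i))"
    have "t j = (s(r := i, b := min (s b + (s r - Suc i)) (Suc (length w)))) j" for j
      using fun_cong[OF t(3), of j] t(1) assms(1) by (auto split: if_splits)
    then show "?P i (exec w (Inc b) t)" using t(2) assms(1) by (auto simp: fun_eq_iff)
  qed (use assms in auto)
  then show ?thesis by (simp add: add_to_def)
qed

lemma exec_subtract_from:
  assumes "r \<noteq> b" and "bounded_store w s"
  shows "exec w (subtract_from r b) s = s(r := 0, b := s b - s r)"
proof -
  let ?P = "\<lambda>i t. t = s(r := i, b := s b - (s r - i))"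
  have "?P 0 (exec w (Loop r (Dec b)) s) \<and> exec w (Loop r (Dec b)) s r = 0"
  proof (rule exec_Loop_invariant[where P = ?P])
    show "valid (Loop r (Dec b))" using assms by simp
    show "?P (s r) s" by (auto simp: fun_eq_iff)
  next
    fix i t assume t: "t r = i" "i < s r" "?P (Suc i) (t(r := Suc i))"
    have "t j = (s(r := i, b := s b - (s r - Suc i))) j" for j
      using fun_cong[OF t(3), of j] t(1) assms(1) by (auto split: if_splits)
    then show "?P i (exec w (Dec b) t)" using t(2) assms(1) by (auto simp: fun_eq_iff)
  qed (use assms in auto)
  then show ?thesis by (simp add: subtract_from_def)
qed

lemma exec_copy:
  assumes neq: "r \<noteq> b" "r \<noteq> u" "b \<noteq> u" and bounded: "bounded_store w s"
  shows "exec w (copy r b u) s = s(b := s r, u := 0)"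
proof -
  let ?c = "Seq (Inc b) (Inc u)" and ?s = "s(b := 0, u := 0)"
  let ?P = "\<lambda>i t. t = s(r := i, b := s r - i, u := s r - i)"
  have s: "bounded_store w ?s" using bounded by (simp add: bounded_store_def)
  have r: "s r \<le> Suc (length w)" using bounded by (simp add: bounded_store_def)
  have "?P 0 (exec w (Loop r ?c) ?s) \<and> exec w (Loop r ?c) ?s r = 0"
  proof (rule exec_Loop_invariant[where P = ?P])
    show "valid (Loop r ?c)" using assms by simp
    show "?P (?s r) ?s" using neq by (auto simp: fun_eq_iff)
  next
    fix i t assume t: "t r = i" "i < ?s r" "?P (Suc i) (t(r := Suc i))"
    have "t j = (s(r := i, b := s r - Suc i, u := s r - Suc i)) j" for j
      using fun_cong[OF t(3), of j] t(1) neq by (auto split: if_splits)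
    then show "?P i (exec w ?c t)" using t(2) neq r by (auto simp: fun_eq_iff)
  qed (rule s)
  then have loop: "exec w (Loop r ?c) ?s = s(r := 0, b := s r, u := s r)" by simp
  have "bounded_store w (s(r := 0, b := s r, u := s r))"
    using bounded by (simp add: bounded_store_def)
  from exec_add_to[of u r, OF neq(2)[symmetric] this] show ?thesis
    unfolding copy_def exec.simps(5) exec_clear loop using neq r by (auto simp: fun_eq_iff)
qed

text \<open>Variables are kept in the registers given by \<open>\<rho>\<close>; registers from \<open>b\<close> on are scratch space, and
  the result is left in register \<open>b\<close>. Since registers hold at most \<open>Suc (length w)\<close>, terms are only
  computed up to that bound.\<close>

definition computable :: "(bool list \<Rightarrow> store \<Rightarrow> nat) \<Rightarrow> bool" where
  "computable t \<longleftrightarrow> (\<forall>\<rho> b. (\<forall>i. \<rho> i < b) \<longrightarrow>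
     (\<exists>c. valid c \<and> (\<forall>w s. bounded_store w s \<longrightarrow>
        exec w c s b = min (t w (s \<circ> \<rho>)) (Suc (length w)) \<and> (\<forall>i<b. exec w c s i = s i))))"

definition decidable :: "(bool list \<Rightarrow> store \<Rightarrow> bool) \<Rightarrow> bool" where
  "decidable P \<longleftrightarrow> (\<forall>\<rho> b. (\<forall>i. \<rho> i < b) \<longrightarrow>
     (\<exists>c. valid c \<and> (\<forall>w s. bounded_store w s \<longrightarrow>
        (exec w c s b \<noteq> 0 \<longleftrightarrow> P w (s \<circ> \<rho>)) \<and> (\<forall>i<b. exec w c s i = s i))))"

lemma computableI:
  assumes "\<And>\<rho> b. (\<And>i. \<rho> i < b) \<Longrightarrow> \<exists>c. valid c \<and> (\<forall>w s. bounded_store w s \<longrightarrow>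
     exec w c s b = min (t w (s \<circ> \<rho>)) (Suc (length w)) \<and> (\<forall>i<b. exec w c s i = s i))"
  shows "computable t"
  using assms by (simp add: computable_def)

lemma computableE:
  assumes "computable t" and "\<And>i. \<rho> i < b"
  obtains c where "valid c"
    and "\<And>w s. bounded_store w s \<Longrightarrow> exec w c s b = min (t w (s \<circ> \<rho>)) (Suc (length w))"
    and "\<And>w s i. bounded_store w s \<Longrightarrow> i < b \<Longrightarrow> exec w c s i = s i"
proof -
  have "\<exists>c. valid c \<and> (\<forall>w s. bounded_store w s \<longrightarrow>
      exec w c s b = min (t w (s \<circ> \<rho>)) (Suc (length w)) \<and> (\<forall>i<b. exec w c s i = s i))"
    using assms unfolding computable_def by blast
  then show thesis using that by blast
qed

lemma decidableI:
  assumes "\<And>\<rho> b. (\<And>i. \<rho> i < b) \<Longrightarrow> \<exists>c. valid c \<and> (\<forall>w s. bounded_store w s \<longrightarrow>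
     (exec w c s b \<noteq> 0 \<longleftrightarrow> P w (s \<circ> \<rho>)) \<and> (\<forall>i<b. exec w c s i = s i))"
  shows "decidable P"
  using assms by (simp add: decidable_def)

lemma decidableE:
  assumes "decidable P" and "\<And>i. \<rho> i < b"
  obtains c where "valid c"
    and "\<And>w s. bounded_store w s \<Longrightarrow> exec w c s b \<noteq> 0 \<longleftrightarrow> P w (s \<circ> \<rho>)"
    and "\<And>w s i. bounded_store w s \<Longrightarrow> i < b \<Longrightarrow> exec w c s i = s i"
proof -
  have "\<exists>c. valid c \<and> (\<forall>w s. bounded_store w s \<longrightarrow>
      (exec w c s b \<noteq> 0 \<longleftrightarrow> P w (s \<circ> \<rho>)) \<and> (\<forall>i<b. exec w c s i = s i))"
    using assms unfolding decidable_def by blast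
  then show thesis using that by blast
qed

lemma comp_cong_less:
  assumes "\<And>i. \<rho> i < b" and "\<And>i. i < b \<Longrightarrow> s i = t i"
  shows "s \<circ> \<rho> = t \<circ> \<rho>"
  using assms by (simp add: fun_eq_iff)

section \<open>Terms\<close>

lemma computable_var: "computable (\<lambda>w e. e i)"
proof (rule computableI)
  fix \<rho> :: "nat \<Rightarrow> nat" and b assume \<rho>: "\<And>i. \<rho> i < b"
  have neq: "\<rho> i \<noteq> b" "\<rho> i \<noteq> Suc b" using \<rho>[of i] by auto
  show "\<exists>c. valid c \<and> (\<forall>w s. bounded_store w s \<longrightarrow>
      exec w c s b = min ((s \<circ> \<rho>) i) (Suc (length w)) \<and> (\<forall>i<b. exec w c s i = s i))"
    using neq by (intro exI[of _ "copy (\<rho> i) b (Suc b)"])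
      (auto simp: exec_copy bounded_store_def)
qed

lemma computable_0: "computable (\<lambda>w e. 0)"
  by (rule computableI) (auto intro!: exI[of _ "clear _"])

lemma computable_Suc:
  assumes "computable t"
  shows "computable (\<lambda>w e. Suc (t w e))"
proof (rule computableI)
  fix \<rho> :: "nat \<Rightarrow> nat" and b assume \<rho>: "\<And>i. \<rho> i < b"
  from assms \<rho> obtain c where c: "valid c"
    "\<And>w s. bounded_store w s \<Longrightarrow> exec w c s b = min (t w (s \<circ> \<rho>)) (Suc (length w))"
    "\<And>w s i. bounded_store w s \<Longrightarrow> i < b \<Longrightarrow> exec w c s i = s i"
    by (rule computableE) (assumption | rule that)+
  show "\<exists>c. valid c \<and> (\<forall>w s. bounded_store w s \<longrightarrow>
      exec w c s b = min (Suc (t w (s \<circ> \<rho>))) (Suc (length w)) \<and> (\<forall>i<b. exec w c s i = s i))"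
    using c by (intro exI[of _ "Seq c (Inc b)"]) auto
qed

lemma computable_const: "computable (\<lambda>w e. n)"
  by (induction n) (auto intro: computable_0 computable_Suc)

text \<open>The second operand is computed with its scratch space starting at \<open>Suc b\<close>,
  which protects the first result in \<open>b\<close>. For such nesting \<open>computable\<close>
  quantifies over all \<open>b\<close>.\<close>

lemma computable_add:
  assumes "computable t" and "computable u"
  shows "computable (\<lambda>w e. t w e + u w e)"
proof (rule computableI)
  fix \<rho> :: "nat \<Rightarrow> nat" and b assume \<rho>: "\<And>i. \<rho> i < b"
  then have \<rho>': "\<And>i. \<rho> i < Suc b" using less_SucI by blast
  from assms(1) \<rho> obtain c where c: "valid c"
    "\<And>w s. bounded_store w s \<Longrightarrow> exec w c s b = min (t w (s \<circ> \<rho>)) (Suc (length w))"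
    "\<And>w s i. bounded_store w s \<Longrightarrow> i < b \<Longrightarrow> exec w c s i = s i"
    by (rule computableE) (assumption | rule that)+
  from assms(2) \<rho>' obtain d where d: "valid d"
    "\<And>w s. bounded_store w s \<Longrightarrow> exec w d s (Suc b) = min (u w (s \<circ> \<rho>)) (Suc (length w))"
    "\<And>w s i. bounded_store w s \<Longrightarrow> i < Suc b \<Longrightarrow> exec w d s i = s i"
    by (rule computableE) (assumption | rule that)+
  let ?c = "Seq c (Seq d (add_to (Suc b) b))"
  have "exec w ?c s b = min (t w (s \<circ> \<rho>) + u w (s \<circ> \<rho>)) (Suc (length w)) \<and>
      (\<forall>i<b. exec w ?c s i = s i)" if s: "bounded_store w s" for w s
  proof -
    let ?s = "exec w c s"
    have s': "bounded_store w ?s" "bounded_store w (exec w d ?s)"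
      using s bounded_store_exec by blast+
    have "?s \<circ> \<rho> = s \<circ> \<rho>" by (rule comp_cong_less[OF \<rho> c(3)[OF s]])
    then show ?thesis using c(2,3)[OF s] d(2,3)[OF s'(1)] exec_add_to[of "Suc b" b, OF _ s'(2)]
      by auto
  qed
  then show "\<exists>c. valid c \<and> (\<forall>w s. bounded_store w s \<longrightarrow>
      exec w c s b = min (t w (s \<circ> \<rho>) + u w (s \<circ> \<rho>)) (Suc (length w)) \<and>
      (\<forall>i<b. exec w c s i = s i))"
    using c(1) d(1) by (intro exI[of _ ?c]) auto
qed

lemma computable_mult_const: "computable t \<Longrightarrow> computable (\<lambda>w e. n * t w e)"
  by (induction n) (auto intro: computable_0 computable_add)

text \<open>This triangular number is the length of the columns before column \<open>e i\<close> of
  the adjacency matrix. A counter runs down from the value of the variable and each of its values is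
  added up; saturating at every addition gives the truncated sum because all summands are
  nonnegative.\<close>

lemma computable_sum_var: "computable (\<lambda>w e. \<Sum>{..<e i})"
proof (rule computableI)
  fix \<rho> :: "nat \<Rightarrow> nat" and b assume \<rho>: "\<And>i. \<rho> i < b"
  let ?u = "Suc b" and ?x = "Suc (Suc b)" and ?y = "Suc (Suc (Suc b))"
  let ?d = "Seq (copy ?u ?x ?y) (add_to ?x b)"
  let ?c = "Seq (Seq (copy (\<rho> i) ?u ?x) (clear b)) (Loop ?u ?d)"
  have neq: "\<rho> i \<noteq> b" "\<rho> i \<noteq> ?u" "\<rho> i \<noteq> ?x" using \<rho>[of i] by auto
  have d: "exec w ?d s = s(?x := 0, ?y := 0, b := min (s b + s ?u) (Suc (length w)))"
    if "bounded_store w s" for w s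
  proof -
    have "bounded_store w (s(?x := s ?u, ?y := 0))" using that by (simp add: bounded_store_def)
    then show ?thesis using that by (auto simp: exec_copy exec_add_to fun_eq_iff)
  qed
  have valid: "valid (Loop ?u ?d)" using d by (simp del: exec.simps)
  have "exec w ?c s b = min (\<Sum>{..<(s \<circ> \<rho>) i}) (Suc (length w)) \<and> (\<forall>j<b. exec w ?c s j = s j)"
    if s: "bounded_store w s" for w s
  proof -
    let ?s = "s(?u := s (\<rho> i), ?x := 0, b := 0)"
    have s': "bounded_store w ?s" using s by (simp add: bounded_store_def)
    let ?P = "\<lambda>j t. t b = min (\<Sum>{j..<s (\<rho> i)}) (Suc (length w)) \<and> (\<forall>l<b. t l = s l)"
    have "?P 0 (exec w (Loop ?u ?d) ?s) \<and> exec w (Loop ?u ?d) ?s ?u = 0"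
    proof (rule exec_Loop_invariant[where P = ?P])
      fix j t
      assume t: "bounded_store w t" "t ?u = j" "j < ?s ?u" "?P (Suc j) (t(?u := Suc j))"
      have "\<Sum>{j..<s (\<rho> i)} = j + \<Sum>{Suc j..<s (\<rho> i)}"
        using t(3) by (simp add: sum.atLeast_Suc_lessThan)
      then show "?P j (exec w ?d t)" unfolding d[OF t(1)] using t by auto
    qed (use valid s' in auto)
    then show ?thesis using s neq by (simp add: exec_copy atLeast0LessThan)
  qed
  then show "\<exists>c. valid c \<and> (\<forall>w s. bounded_store w s \<longrightarrow>
      exec w c s b = min (\<Sum>{..<(s \<circ> \<rho>) i}) (Suc (length w)) \<and> (\<forall>i<b. exec w c s i = s i))"
    using valid neq by (intro exI[of _ ?c]) auto
qed

section \<open>Atomic predicates, connectives and bounded quantifiers\<close>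

lemma decidable_symbol_at:
  assumes "computable t"
  shows "decidable (\<lambda>w e. symbol_at w (t w e) = a)"
proof (rule decidableI)
  fix \<rho> :: "nat \<Rightarrow> nat" and b assume \<rho>: "\<And>i. \<rho> i < b"
  from assms \<rho> obtain c where c: "valid c"
    "\<And>w s. bounded_store w s \<Longrightarrow> exec w c s b = min (t w (s \<circ> \<rho>)) (Suc (length w))"
    "\<And>w s i. bounded_store w s \<Longrightarrow> i < b \<Longrightarrow> exec w c s i = s i"
    by (rule computableE) (assumption | rule that)+
  \<comment> \<open>Here truncation becomes invisible: the cell \<open>Suc (length w)\<close> is as
    blank as all cells behind it.\<close>
  have min: "symbol_at w (min v (Suc (length w))) = symbol_at w v" for w v
    by (auto simp: symbol_at_def min_def)
  let ?c = "Seq c (Cond b {a} (Seq (clear b) (Inc b)) (clear b))"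
  show "\<exists>c. valid c \<and> (\<forall>w s. bounded_store w s \<longrightarrow>
      (exec w c s b \<noteq> 0 \<longleftrightarrow> symbol_at w (t w (s \<circ> \<rho>)) = a) \<and> (\<forall>i<b. exec w c s i = s i))"
    using c by (intro exI[of _ ?c]) (auto simp: min)
qed

text \<open>Truncated subtraction is nonzero exactly if the inequality holds. Variables are held
  exactly, while two computed terms could both be cut to the same value.\<close>

lemma decidable_less: "decidable (\<lambda>w e. e i < e j)"
proof (rule decidableI)
  fix \<rho> :: "nat \<Rightarrow> nat" and b assume \<rho>: "\<And>i. \<rho> i < b"
  let ?u = "Suc b" and ?x = "Suc (Suc b)"
  let ?c = "Seq (copy (\<rho> j) b ?x) (Seq (copy (\<rho> i) ?u ?x) (subtract_from ?u b))"
  have neq: "\<rho> j \<noteq> b" "\<rho> j \<noteq> ?x" "\<rho> i \<noteq> b" "\<rho> i \<noteq> ?u" "\<rho> i \<noteq> ?x"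
    using \<rho>[of i] \<rho>[of j] by auto
  have "exec w ?c s = s(b := s (\<rho> j) - s (\<rho> i), ?u := 0, ?x := 0)"
    if s: "bounded_store w s" for w s
  proof -
    have "bounded_store w (s(b := s (\<rho> j), ?x := 0))"
      "bounded_store w (s(b := s (\<rho> j), ?x := 0, ?u := s (\<rho> i), ?x := 0))"
      using s by (auto simp: bounded_store_def)
    then show ?thesis using s neq by (auto simp: exec_copy exec_subtract_from fun_eq_iff)
  qed
  then show "\<exists>c. valid c \<and> (\<forall>w s. bounded_store w s \<longrightarrow>
      (exec w c s b \<noteq> 0 \<longleftrightarrow> (s \<circ> \<rho>) i < (s \<circ> \<rho>) j) \<and> (\<forall>i<b. exec w c s i = s i))"
    using neq by (intro exI[of _ ?c]) (simp add: not_le del: exec.simps)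
qed

lemma decidable_not:
  assumes "decidable P"
  shows "decidable (\<lambda>w e. \<not> P w e)"
proof (rule decidableI)
  fix \<rho> :: "nat \<Rightarrow> nat" and b assume \<rho>: "\<And>i. \<rho> i < b"
  from assms \<rho> obtain c where c: "valid c"
    "\<And>w s. bounded_store w s \<Longrightarrow> exec w c s b \<noteq> 0 \<longleftrightarrow> P w (s \<circ> \<rho>)"
    "\<And>w s i. bounded_store w s \<Longrightarrow> i < b \<Longrightarrow> exec w c s i = s i"
    by (rule decidableE) (assumption | rule that)+
  let ?c = "Seq c (Cond b {3} (Inc b) (clear b))"
  show "\<exists>c. valid c \<and> (\<forall>w s. bounded_store w s \<longrightarrow>
      (exec w c s b \<noteq> 0 \<longleftrightarrow> \<not> P w (s \<circ> \<rho>)) \<and> (\<forall>i<b. exec w c s i = s i))"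
    using c(1) by (intro exI[of _ ?c]) (auto simp: c(3) simp flip: c(2))
qed

lemma decidable_and:
  assumes "decidable P" and "decidable Q"
  shows "decidable (\<lambda>w e. P w e \<and> Q w e)"
proof (rule decidableI)
  fix \<rho> :: "nat \<Rightarrow> nat" and b assume \<rho>: "\<And>i. \<rho> i < b"
  then have \<rho>': "\<And>i. \<rho> i < Suc b" using less_SucI by blast
  from assms(1) \<rho> obtain c where c: "valid c"
    "\<And>w s. bounded_store w s \<Longrightarrow> exec w c s b \<noteq> 0 \<longleftrightarrow> P w (s \<circ> \<rho>)"
    "\<And>w s i. bounded_store w s \<Longrightarrow> i < b \<Longrightarrow> exec w c s i = s i"
    by (rule decidableE) (assumption | rule that)+
  from assms(2) \<rho>' obtain d where d: "valid d"
    "\<And>w s. bounded_store w s \<Longrightarrow> exec w d s (Suc b) \<noteq> 0 \<longleftrightarrow> Q w (s \<circ> \<rho>)"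
    "\<And>w s i. bounded_store w s \<Longrightarrow> i < Suc b \<Longrightarrow> exec w d s i = s i"
    by (rule decidableE) (assumption | rule that)+
  let ?c = "Seq c (Seq d (Cond (Suc b) {3} (clear b) Skip))"
  have "(exec w ?c s b \<noteq> 0 \<longleftrightarrow> P w (s \<circ> \<rho>) \<and> Q w (s \<circ> \<rho>)) \<and> (\<forall>i<b. exec w ?c s i = s i)"
    if s: "bounded_store w s" for w s
  proof -
    have s': "bounded_store w (exec w c s)" using s by (rule bounded_store_exec)
    have "exec w c s \<circ> \<rho> = s \<circ> \<rho>" by (rule comp_cong_less[OF \<rho> c(3)[OF s]])
    then show ?thesis using c(2,3)[OF s] d(2,3)[OF s'] by auto
  qed
  then show "\<exists>c. valid c \<and> (\<forall>w s. bounded_store w s \<longrightarrow>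
      (exec w c s b \<noteq> 0 \<longleftrightarrow> P w (s \<circ> \<rho>) \<and> Q w (s \<circ> \<rho>)) \<and> (\<forall>i<b. exec w c s i = s i))"
    using c(1) d(1) by (intro exI[of _ ?c]) auto
qed

text \<open>Register \<open>b\<close> collects whether a witness has been seen, and
  \<open>Suc b\<close> runs through the candidates; redirecting variable \<open>i\<close> to
  \<open>Suc b\<close> in \<open>\<rho>\<close> binds it. Filling \<open>Suc b\<close> to
  \<open>length w + 1\<close> is right because the loop decrements first: the body sees precisely
  \<open>length w\<close>, ..., 0.\<close>

lemma decidable_ex:
  assumes "decidable P"
  shows "decidable (\<lambda>w e. \<exists>x \<le> length w. P w (e(i := x)))"
proof (rule decidableI)
  fix \<rho> :: "nat \<Rightarrow> nat" and b assume \<rho>: "\<And>i. \<rho> i < b"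
  let ?x = "Suc b" and ?y = "Suc (Suc b)"
  let ?\<rho> = "\<rho>(i := ?x)"
  have "?\<rho> j < ?y" for j using \<rho>[of j] by auto
  with assms obtain c where c: "valid c"
    "\<And>w s. bounded_store w s \<Longrightarrow> exec w c s ?y \<noteq> 0 \<longleftrightarrow> P w (s \<circ> ?\<rho>)"
    "\<And>w s i. bounded_store w s \<Longrightarrow> i < ?y \<Longrightarrow> exec w c s i = s i"
    by (rule decidableE) (assumption | rule that)+
  let ?d = "Seq c (Cond ?y {3} Skip (Inc b))"
  let ?c = "Seq (Seq (clear b) (Fill ?x)) (Loop ?x ?d)"
  have valid: "valid (Loop ?x ?d)" using c by simp
  have "(exec w ?c s b \<noteq> 0 \<longleftrightarrow> (\<exists>x \<le> length w. P w ((s \<circ> \<rho>)(i := x)))) \<and>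
      (\<forall>j<b. exec w ?c s j = s j)"
    if s: "bounded_store w s" for w s
  proof -
    let ?s = "s(b := 0, ?x := Suc (length w))"
    have s': "bounded_store w ?s" using s by (simp add: bounded_store_def)
    let ?P = "\<lambda>j t. (t b \<noteq> 0 \<longleftrightarrow> (\<exists>x \<in> {j..length w}. P w ((s \<circ> \<rho>)(i := x)))) \<and>
      (\<forall>l<b. t l = s l)"
    have "?P 0 (exec w (Loop ?x ?d) ?s) \<and> exec w (Loop ?x ?d) ?s ?x = 0"
    proof (rule exec_Loop_invariant[where P = ?P])
      fix j t
      assume t: "bounded_store w t" "t ?x = j" "j < ?s ?x" "?P (Suc j) (t(?x := Suc j))"
      have "(t \<circ> ?\<rho>) l = ((s \<circ> \<rho>)(i := j)) l" for l using t \<rho>[of l] by auto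
      then have eq: "t \<circ> ?\<rho> = (s \<circ> \<rho>)(i := j)" by blast
      have "{j..length w} = insert j {Suc j..length w}" using t(3) by auto
      then show "?P j (exec w ?d t)" using t(4) c(2,3)[OF t(1)] unfolding eq by auto
    qed (use valid s' in auto)
    then show ?thesis by (simp add: Bex_def del: fun_upd_apply)
  qed
  then show "\<exists>c. valid c \<and> (\<forall>w s. bounded_store w s \<longrightarrow>
      (exec w c s b \<noteq> 0 \<longleftrightarrow> (\<exists>x \<le> length w. P w ((s \<circ> \<rho>)(i := x)))) \<and>
      (\<forall>i<b. exec w c s i = s i))"
    using valid by (intro exI[of _ ?c]) auto
qed

lemma decidable_polynomial_time:
  assumes "decidable (\<lambda>w _. w \<in> L)"
  shows "polynomial_time_decidable L"
proof -
  let ?\<rho> = "\<lambda>_. 0 :: nat"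
  have "?\<rho> i < Suc 0" for i by simp
  with assms obtain c where c: "valid c"
    "\<And>w s. bounded_store w s \<Longrightarrow> exec w c s (Suc 0) \<noteq> 0 \<longleftrightarrow> w \<in> L"
    by (rule decidableE) (assumption | rule that)+
  \<comment> \<open>With all variables mapped to register 0, the result lands in register 1, but the
    machine answers according to register 0.\<close>
  let ?c = "Seq c (copy (Suc 0) 0 (Suc (Suc 0)))"
  have "exec w ?c (\<lambda>_. 0) 0 \<noteq> 0 \<longleftrightarrow> w \<in> L" for w
  proof -
    have s: "bounded_store w (\<lambda>_. 0)" by (simp add: bounded_store_def)
    then show ?thesis using c(2)[OF s] bounded_store_exec[OF s, of c] by (simp add: exec_copy)
  qed
  then have "{w. exec w ?c (\<lambda>_. 0) 0 \<noteq> 0} = L" by blast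
  moreover have "valid ?c" using c(1) by simp
  ultimately show ?thesis using program_polynomial_time by metis
qed

lemma decidable_const: "decidable (\<lambda>w e. a)"
proof -
  \<comment> \<open>Cell 0 always carries the marker 3, so this atom is constantly true or
    constantly false.\<close>
  have "decidable (\<lambda>w e. symbol_at w 0 = (if a then 3 else 0))"
    by (rule decidable_symbol_at[OF computable_0])
  then show ?thesis by (cases a) (simp_all add: symbol_at_def)
qed

lemma decidable_or: "decidable P \<Longrightarrow> decidable Q \<Longrightarrow> decidable (\<lambda>w e. P w e \<or> Q w e)"
  using decidable_not[OF decidable_and[OF decidable_not decidable_not]] by simp

lemma decidable_imp: "decidable P \<Longrightarrow> decidable Q \<Longrightarrow> decidable (\<lambda>w e. P w e \<longrightarrow> Q w e)"
  using decidable_not[OF decidable_and[OF _ decidable_not]] by simp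

lemma decidable_all:
  "decidable P \<Longrightarrow> decidable (\<lambda>w e. \<forall>x \<le> length w. P w (e(i := x)))"
  using decidable_not[OF decidable_ex[OF decidable_not]] by simp

lemma decidable_finite_all:
  assumes "finite A" and "\<And>a. a \<in> A \<Longrightarrow> decidable (P a)"
  shows "decidable (\<lambda>w e. \<forall>a\<in>A. P a w e)"
  using assms by (induction A) (auto intro: decidable_const decidable_and)

lemma decidable_finite_ex:
  assumes "finite A" and "\<And>a. a \<in> A \<Longrightarrow> decidable (P a)"
  shows "decidable (\<lambda>w e. \<exists>a\<in>A. P a w e)"
  using assms by (induction A) (auto intro: decidable_const decidable_or)

text \<open>Choosing \<open>p\<close> positions becomes \<open>p\<close> nested loops, one for each
  variable below \<open>p\<close>. The program, and with it the degree of the time bound, depends on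
  \<open>p\<close>, which is why \<open>p\<close> has to be constant.\<close>

lemma decidable_ex_fun:
  assumes "decidable P"
  shows "decidable (\<lambda>w e. \<exists>v. (\<forall>a<p. v a \<le> length w) \<and> P w (\<lambda>i. if i < p then v i else e i))"
  using assms
proof (induction p arbitrary: P)
  case 0
  then show ?case by simp
next
  case (Suc p)
  have "decidable (\<lambda>w e. \<exists>v. (\<forall>a<p. v a \<le> length w) \<and>
      (\<exists>x \<le> length w. P w ((\<lambda>i. if i < p then v i else e i)(p := x))))"
    by (rule Suc.IH[OF decidable_ex[OF Suc.prems]])
  moreover have "(\<exists>v. (\<forall>a<p. v a \<le> length w) \<and>
        (\<exists>x \<le> length w. P w ((\<lambda>i. if i < p then v i else e i)(p := x)))) \<longleftrightarrow>
      (\<exists>v. (\<forall>a<Suc p. v a \<le> length w) \<and> P w (\<lambda>i. if i < Suc p then v i else e i))"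
    (is "?L \<longleftrightarrow> ?R") for w e
  proof
    assume ?L
    then obtain v x where v: "\<forall>a<p. v a \<le> length w" "x \<le> length w"
      "P w ((\<lambda>i. if i < p then v i else e i)(p := x))" by blast
    have "(\<lambda>i. if i < p then v i else e i)(p := x) =
        (\<lambda>i. if i < Suc p then (v(p := x)) i else e i)"
      by (auto simp: fun_eq_iff)
    then show ?R using v by (intro exI[of _ "v(p := x)"]) (auto simp: less_Suc_eq)
  next
    assume ?R
    then obtain v where v: "\<forall>a<Suc p. v a \<le> length w"
      "P w (\<lambda>i. if i < Suc p then v i else e i)" by blast
    have "(\<lambda>i. if i < Suc p then v i else e i) = (\<lambda>i. if i < p then v i else e i)(p := v p)"
      by (auto simp: fun_eq_iff)
    then show ?L using v by (intro exI[of _ v]) auto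
  qed
  ultimately show ?case by simp
qed

section \<open>Chromatic numbers and selections\<close>

text \<open>An injective numbering of the vertices is proper. Some coloring must exist before the
  \<open>LEAST\<close> in \<open>chromatic_number\<close> says anything.\<close>

lemma proper_coloring_exists:
  assumes "finite S" and "\<And>e. e \<in> E \<Longrightarrow> e \<subseteq> S \<and> card e = 2"
  shows "\<exists>f. proper_coloring S E (card S) f"
proof -
  from finite_imp_inj_to_nat_seg[OF assms(1)] obtain f and n :: nat where
    f: "f ` S = {i. i < n}" "inj_on f S" by blast
  have "n = card S" using card_image[OF f(2)] f(1) by simp
  moreover have "f x \<noteq> f y" if "{x, y} \<in> E" for x y
  proof -
    have "x \<in> S" "y \<in> S" "x \<noteq> y" using assms(2)[OF that] by auto
    then show ?thesis using f(2) by (auto dest: inj_onD)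
  qed
  moreover have "f \<in> S \<rightarrow> {..<n}" using f(1) by auto
  ultimately show ?thesis unfolding proper_coloring_def by blast
qed

lemma chromatic_number_le: "proper_coloring S E c f \<Longrightarrow> chromatic_number S E \<le> c"
  unfolding chromatic_number_def by (rule Least_le) blast

lemma proper_coloring_chromatic_number:
  assumes "proper_coloring S E c f"
  shows "\<exists>g. proper_coloring S E (chromatic_number S E) g"
  unfolding chromatic_number_def
  by (rule LeastI[where P = "\<lambda>c. \<exists>f. proper_coloring S E c f"]) (use assms in blast)

lemma partition_on_nth_unique:
  assumes "partition_on V (set Us)" and "distinct Us"
    and "a < length Us" and "b < length Us" and "x \<in> Us ! a" and "x \<in> Us ! b"
  shows "a = b"
proof -
  have "Us ! a = Us ! b"
    using assms unfolding partition_on_def disjoint_def by (metis disjoint_iff nth_mem)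
  then show ?thesis using assms by (simp add: nth_eq_iff_index_eq)
qed

text \<open>A selection is a choice of a vertex \<open>v a\<close> in the \<open>a\<close>-th part. As it has \<open>p\<close> elements, \<open>p\<close>
  colors always suffice, and the bound matters only if it is smaller than \<open>p\<close>.\<close>

lemma pcp_yes_iff:
  assumes I: "pcp_instance I" and p: "length (parts I) = p"
  shows "pcp_yes I \<longleftrightarrow> 0 \<le> color_bound I \<and>
    (\<exists>v. (\<forall>a<p. v a < num_vertices I \<and> v a \<in> parts I ! a) \<and>
       (\<exists>f \<in> {..<p} \<rightarrow>\<^sub>E {..<p}.
          (\<forall>a<p. \<forall>b<p. f a = f b \<longrightarrow> v a < v b \<longrightarrow> {v a, v b} \<notin> edges I) \<and>
          (\<forall>c<p. color_bound I = int c \<longrightarrow> (\<forall>a<p. f a < c))))"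
    (is "_ \<longleftrightarrow> _ \<and> (\<exists>v. ?sel v \<and> (\<exists>f \<in> _. ?proper v f \<and> ?few f))")
proof -
  let ?k = "color_bound I" and ?U = "\<lambda>a. parts I ! a"
  have part: "partition_on (vertices I) (set (parts I))" and "distinct (parts I)"
    and E: "\<And>e. e \<in> edges I \<Longrightarrow> card e = 2"
    using I by (auto simp: pcp_instance_def simple_graph_def)
  note disj = partition_on_nth_unique[OF part \<open>distinct (parts I)\<close>, unfolded p]
  have cover: "\<exists>a<p. x \<in> ?U a" if "x \<in> vertices I" for x
    using part that p unfolding partition_on_def by (metis UnionE in_set_conv_nth)
  have sub: "?U a \<subseteq> vertices I" if "a < p" for a
    using part that p unfolding partition_on_def by (metis Sup_upper nth_mem)
  show ?thesis
  proof
    assume "pcp_yes I"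
    then obtain S where S: "S \<subseteq> vertices I" "\<And>a. a < p \<Longrightarrow> card (S \<inter> ?U a) = 1"
      and k: "int (chromatic_number S (induced_edges (edges I) S)) \<le> ?k"
      using p by (auto simp: pcp_yes_def selection_def)
    let ?E = "induced_edges (edges I) S"
    define v where "v a = (SOME x. x \<in> S \<inter> ?U a)" for a
    have Int: "S \<inter> ?U a = {v a}" if a: "a < p" for a
    proof -
      obtain x where "S \<inter> ?U a = {x}" using S(2)[OF a] by (auto simp: card_1_singleton_iff)
      then show ?thesis by (simp add: v_def)
    qed
    then have v: "v a \<in> S" "v a \<in> ?U a" if "a < p" for a using that by blast+
    have "S \<subseteq> v ` {..<p}"
    proof
      fix x assume "x \<in> S"
      moreover obtain a where "a < p" "x \<in> ?U a" using cover S(1) \<open>x \<in> S\<close> by blast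
      ultimately show "x \<in> v ` {..<p}" using Int by blast
    qed
    then have card: "card S \<le> p" using surj_card_le[of "{..<p}" S v] by simp
    have "finite S" using S(1) finite_subset by blast
    then obtain h where h: "proper_coloring S ?E (card S) h"
      using proper_coloring_exists[of S ?E] E by (auto simp: induced_edges_def)
    obtain g where g: "proper_coloring S ?E (chromatic_number S ?E) g"
      using proper_coloring_chromatic_number[OF h] by blast
    then have col: "g (v a) < chromatic_number S ?E" if "a < p" for a
      using v that by (auto simp: proper_coloring_def)
    have "g (v a) < p" if "a < p" for a
      using col[OF that] chromatic_number_le[OF h] card by simp
    \<comment> \<open>Restricting puts the coloring of the indices into a finite set of extensional
      functions, so that the search for it is a finite disjunction.\<close>
    then have "restrict (g \<circ> v) {..<p} \<in> {..<p} \<rightarrow>\<^sub>E {..<p}" by (simp add: restrict_PiE_iff)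
    moreover have "?proper v (restrict (g \<circ> v) {..<p})"
      using g v by (auto simp: proper_coloring_def induced_edges_def)
    moreover have "?few (restrict (g \<circ> v) {..<p})"
    proof (intro allI impI)
      fix c a assume "?k = int c" "a < p"
      then show "restrict (g \<circ> v) {..<p} a < c" using col[of a] k by simp
    qed
    moreover have "?sel v" using v sub by blast
    moreover have "0 \<le> ?k" using k by linarith
    ultimately show "0 \<le> ?k \<and> (\<exists>v. ?sel v \<and> (\<exists>f \<in> {..<p} \<rightarrow>\<^sub>E {..<p}. ?proper v f \<and> ?few f))"
      by blast
  next
    assume "0 \<le> ?k \<and> (\<exists>v. ?sel v \<and> (\<exists>f \<in> {..<p} \<rightarrow>\<^sub>E {..<p}. ?proper v f \<and> ?few f))"
    then obtain v f where k: "0 \<le> ?k" and v: "?sel v" and f: "f \<in> {..<p} \<rightarrow>\<^sub>E {..<p}"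
      "?proper v f" "?few f" by blast
    define S where "S = v ` {..<p}"
    \<comment> \<open>The coloring \<open>f\<close> is constrained by the bound only if the bound is
      below \<open>p\<close>; otherwise its values are below \<open>p\<close> anyway. The minimum
      covers both cases.\<close>
    define c where "c = min (nat ?k) p"
    have inj: "inj_on v {..<p}" using v disj by (auto intro!: inj_onI) metis
    have "S \<inter> ?U a = {v a}" if "a < p" for a
      using v disj[OF _ that] that by (auto simp: S_def)
    then have sel: "selection (vertices I) (set (parts I)) S"
      using v p by (auto simp: selection_def S_def in_set_conv_nth)
    define g where "g = f \<circ> inv_into {..<p} v"
    have g: "g (v a) = f a" if "a < p" for a using inj that by (simp add: g_def)
    have "f a < c" if "a < p" for a
      using f k that by (cases "nat ?k < p") (auto simp: c_def PiE_iff)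
    then have "g \<in> S \<rightarrow> {..<c}" using g by (auto simp: S_def)
    moreover have "g x \<noteq> g y" if xy: "{x, y} \<in> induced_edges (edges I) S" for x y
    proof
      assume eq: "g x = g y"
      \<comment> \<open>Properness of \<open>f\<close> speaks only about pairs with
        \<open>v a < v b\<close>, the pairs that the upper triangle stores. An edge is thus
        considered in both orientations.\<close>
      obtain a b where ab: "a < p" "x = v a" "b < p" "y = v b"
        using xy by (auto simp: induced_edges_def S_def)
      have "x \<noteq> y" "{x, y} \<in> edges I" "{y, x} \<in> edges I"
        using xy E[of "{x, y}"] by (auto simp: induced_edges_def insert_commute)
      then show False using f(2) ab eq g by (metis linorder_neqE_nat)
    qed
    ultimately have "proper_coloring S (induced_edges (edges I) S) c g"
      by (simp add: proper_coloring_def)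
    from chromatic_number_le[OF this] have
      "int (chromatic_number S (induced_edges (edges I) S)) \<le> ?k"
      using k by (simp add: c_def) linarith
    then show "pcp_yes I" using sel by (auto simp: pcp_yes_def)
  qed
qed

section \<open>Reading the encoding\<close>

text \<open>Blocks of varying length \<open>l j\<close> cover both tables of the encoding:
  \<open>l j = j\<close> for the triangle, constant \<open>l\<close> for the characteristic
  vectors.\<close>

lemma length_blocks: "length (concat (map (\<lambda>j. map (f j) [0..<l j]) [0..<n])) = sum l {..<n}"
  by (induction n) auto

lemma nth_blocks:
  assumes "j < n" and "i < l j"
  shows "concat (map (\<lambda>j. map (f j) [0..<l j]) [0..<n]) ! (sum l {..<j} + i) = f j i"
  using assms(1)
proof (induction n)
  case (Suc n)
  show ?case
  proof (cases "j = n")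
    case True
    then show ?thesis using assms(2) by (simp add: nth_append length_blocks)
  next
    case False
    then have "sum l {..<Suc j} \<le> sum l {..<n}" using Suc.prems by (intro sum_mono2) auto
    then have "sum l {..<j} + i < sum l {..<n}" using assms(2) by simp
    then show ?thesis using Suc False by (simp add: nth_append length_blocks)
  qed
qed simp

lemma blocks_eq_take:
  assumes "sum l {..<n} \<le> length u"
  shows "concat (map (\<lambda>j. map (\<lambda>i. u ! (sum l {..<j} + i)) [0..<l j]) [0..<n]) =
    take (sum l {..<n}) u"
  using assms
proof (induction n)
  case (Suc n)
  have "map (\<lambda>i. u ! (sum l {..<n} + i)) [0..<l n] = take (l n) (drop (sum l {..<n}) u)"
    using Suc.prems by (intro nth_equalityI) auto
  then show ?case using Suc by (simp add: take_add)
qed simp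

section \<open>Binary numerals as words\<close>

lemma binary_small: "binary 0 = []" "binary (Suc 0) = [True]"
  by (simp_all add: binary.simps[of 0] binary.simps[of "Suc 0"])

lemma binary_Cons_False: "binary n \<noteq> False # xs"
proof (induction n arbitrary: xs rule: less_induct)
  case (less n)
  show ?case
  proof (cases "n < 2")
    case True
    then have "n = 0 \<or> n = 1" by auto
    then show ?thesis by (auto simp: binary_small)
  next
    case False
    then have "binary n = binary (n div 2) @ [odd n]" "binary (n div 2) \<noteq> []"
      by (auto simp: binary.simps[of n] binary.simps[of "n div 2"])
    moreover have "binary (n div 2) \<noteq> False # ys" for ys using less False by auto
    ultimately show ?thesis by (metis append_eq_Cons_conv)
  qed
qed

text \<open>Zero is the empty word, so a word is a numeral as soon as it does not start with
  \<open>False\<close>. Testing a single cell therefore validates a numeral of any length.\<close>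

lemma binary_surj: "(\<And>ys. xs \<noteq> False # ys) \<Longrightarrow> \<exists>n. xs = binary n"
proof (induction xs rule: rev_induct)
  case Nil
  then show ?case by (intro exI[of _ 0]) (simp add: binary_small)
next
  case (snoc x xs)
  have "xs \<noteq> False # ys" for ys using snoc.prems[of "ys @ [x]"] by auto
  then obtain n where n: "xs = binary n" using snoc.IH by blast
  show ?case
  proof (cases "n = 0")
    case True
    then have "xs = []" using n by (simp add: binary_small)
    then have "xs @ [x] = binary 1" using snoc.prems[of "[]"] by (simp add: binary_small)
    then show ?thesis by blast
  next
    case False
    then have "xs @ [x] = binary (2 * n + of_bool x)"
      using n by (cases x) (auto simp: binary.simps[of "2 * n"] binary.simps[of "Suc (2 * n)"])
    then show ?thesis by blast
  qed
qed

section \<open>Positions in a code and the shape of codes\<close>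

lemma symbol_at_Suc:
  "symbol_at w (Suc i) = 2 \<longleftrightarrow> i < length w \<and> w ! i"
  "symbol_at w (Suc i) = 1 \<longleftrightarrow> i < length w \<and> \<not> w ! i"
  by (auto simp: symbol_at_def)

lemma symbol_at_drop: "symbol_at (drop m w) (Suc i) = symbol_at w (Suc (m + i))"
  by (auto simp: symbol_at_def)

text \<open>\<open>p + 2\<close> accounts for the second unary number and the two terminators. With
  \<open>p\<close> constant, the position uses only sums, constants and one triangular number, all
  of them computable terms.\<close>

definition adj_pos :: "nat \<Rightarrow> nat \<Rightarrow> nat \<Rightarrow> nat \<Rightarrow> nat" where
  "adj_pos p n i j = n + (p + 2) + \<Sum>{..<j} + i"

definition part_pos :: "nat \<Rightarrow> nat \<Rightarrow> nat \<Rightarrow> nat \<Rightarrow> nat" where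
  "part_pos p n a x = n + (p + 2) + \<Sum>{..<n} + a * n + x"

definition bound_pos :: "nat \<Rightarrow> nat \<Rightarrow> nat" where
  "bound_pos p n = n + (p + 2) + \<Sum>{..<n} + p * n"

abbreviation bit_at :: "bool list \<Rightarrow> nat \<Rightarrow> bool" where
  "bit_at w i \<equiv> symbol_at w (Suc i) = 2"

text \<open>The guards \<open>x \<le> length w\<close> and the sets \<open>{..<p}\<close> keep two
  kinds of quantifiers apart: the former are evaluated by loops, the latter are expanded into finite
  conjunctions.\<close>

definition header :: "nat \<Rightarrow> bool list \<Rightarrow> nat \<Rightarrow> bool" where
  "header p w n \<longleftrightarrow> (\<forall>x \<le> length w. x < n \<longrightarrow> bit_at w x) \<and> symbol_at w (Suc n) = 1 \<and>
     (\<forall>a \<in> {..<p}. bit_at w (n + Suc a)) \<and> symbol_at w (Suc (n + Suc p)) = 1"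

text \<open>Every vertex lies in exactly one part, and no part is empty. Distinctness of the parts
  follows, since two equal nonempty parts would share a vertex.\<close>

definition partition_code :: "nat \<Rightarrow> bool list \<Rightarrow> nat \<Rightarrow> bool" where
  "partition_code p w n \<longleftrightarrow>
     (\<forall>x \<le> length w. x < n \<longrightarrow>
        (\<exists>a \<in> {..<p}. bit_at w (part_pos p n a x) \<and>
           (\<forall>b \<in> {..<p} - {a}. \<not> bit_at w (part_pos p n b x)))) \<and>
     (\<forall>a \<in> {..<p}. \<exists>x \<le> length w. x < n \<and> bit_at w (part_pos p n a x))"

lemma encode_blocks:
  assumes "length (parts I) = p"
  shows "encode I = (replicate (num_vertices I) True @ False # replicate p True @ [False]) @
    concat (map (\<lambda>j. map (\<lambda>i. {i, j} \<in> edges I) [0..<j]) [0..<num_vertices I]) @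
    concat (map (\<lambda>a. map (\<lambda>x. x \<in> parts I ! a) [0..<num_vertices I]) [0..<p]) @
    (color_bound I < 0) # binary (nat \<bar>color_bound I\<bar>)"
proof -
  have "map (\<lambda>U. map (\<lambda>v. v \<in> U) [0..<num_vertices I]) (parts I) =
      map (\<lambda>a. map (\<lambda>x. x \<in> parts I ! a) [0..<num_vertices I]) [0..<p]"
    using assms by (intro nth_equalityI) auto
  then show ?thesis by (simp add: encode_def assms)
qed

lemma encode_facts:
  fixes I :: pcp and p :: nat
  assumes "length (parts I) = p"
  defines "n \<equiv> num_vertices I"
  shows "header p (encode I) n"
    and "i < j \<Longrightarrow> j < n \<Longrightarrow> bit_at (encode I) (adj_pos p n i j) \<longleftrightarrow> {i, j} \<in> edges I"
    and "a < p \<Longrightarrow> x < n \<Longrightarrow> bit_at (encode I) (part_pos p n a x) \<longleftrightarrow> x \<in> parts I ! a"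
    and "drop (bound_pos p n) (encode I) = (color_bound I < 0) # binary (nat \<bar>color_bound I\<bar>)"
    and "n \<le> length (encode I)"
proof -
  let ?H = "replicate n True @ False # replicate p True @ [False]"
  let ?A = "concat (map (\<lambda>j. map (\<lambda>i. {i, j} \<in> edges I) [0..<j]) [0..<n])"
  let ?P = "concat (map (\<lambda>a. map (\<lambda>x. x \<in> parts I ! a) [0..<n]) [0..<p])"
  let ?B = "(color_bound I < 0) # binary (nat \<bar>color_bound I\<bar>)"
  have w: "encode I = ?H @ ?A @ ?P @ ?B"
    using encode_blocks[OF assms(1)] by (simp add: n_def)
  have H: "length ?H = n + (p + 2)" by simp
  have A: "length ?A = \<Sum>{..<n}" using length_blocks[of "\<lambda>j i. {i, j} \<in> edges I" "\<lambda>j. j" n] .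
  have P: "length ?P = p * n" using length_blocks[of "\<lambda>a x. x \<in> parts I ! a" "\<lambda>_. n" p] by simp
  show "n \<le> length (encode I)" unfolding w by simp
  show "header p (encode I) n"
    unfolding header_def symbol_at_Suc w by (auto simp: nth_append nth_Cons')
  show "drop (bound_pos p n) (encode I) = ?B"
    unfolding w bound_pos_def using H A P by (simp del: length_concat)
  show "bit_at (encode I) (adj_pos p n i j) \<longleftrightarrow> {i, j} \<in> edges I" if "i < j" "j < n"
  proof -
    have "\<Sum>{..<Suc j} \<le> \<Sum>{..<n}" using that by (intro sum_mono2) auto
    then have less: "\<Sum>{..<j} + i < \<Sum>{..<n}" using that by simp
    then have "encode I ! adj_pos p n i j = ?A ! (\<Sum>{..<j} + i)"
      unfolding w adj_pos_def using H A by (simp only: nth_append) simp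
    also have "\<dots> = ({i, j} \<in> edges I)"
      using nth_blocks[of j n i "\<lambda>j. j" "\<lambda>j i. {i, j} \<in> edges I"] that by simp
    finally show ?thesis
      using less H A unfolding symbol_at_Suc adj_pos_def w by (simp del: length_concat)
  qed
  show "bit_at (encode I) (part_pos p n a x) \<longleftrightarrow> x \<in> parts I ! a" if "a < p" "x < n"
  proof -
    have "Suc a * n \<le> p * n" using that by (intro mult_right_mono) auto
    then have less: "a * n + x < p * n" using that by simp
    then have "encode I ! part_pos p n a x = ?P ! (a * n + x)"
      unfolding w part_pos_def using H A P by (simp only: nth_append) simp
    also have "\<dots> = (x \<in> parts I ! a)"
      using nth_blocks[of a p x "\<lambda>_. n" "\<lambda>a x. x \<in> parts I ! a"] that by simp
    finally show ?thesis
      using less H A P unfolding symbol_at_Suc part_pos_def w by (simp del: length_concat)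
  qed
qed

text \<open>The instance is read off the word itself. Any content of the triangle describes a simple
  graph, and \<open>binary_surj\<close> supplies the bound from the remaining bits.\<close>

lemma decode:
  assumes header: "header p w n" and n: "n \<le> length w"
    and sign: "symbol_at w (Suc (bound_pos p n)) = 1"
    and lead: "symbol_at w (Suc (Suc (bound_pos p n))) \<noteq> 1"
  defines "U \<equiv> \<lambda>a. {x. x < n \<and> bit_at w (part_pos p n a x)}"
  obtains k where "encode \<lparr>num_vertices = n,
      edges = {{i, j} |i j. i < j \<and> j < n \<and> bit_at w (adj_pos p n i j)},
      parts = map U [0..<p], color_bound = int k\<rparr> = w"
proof -
  let ?H = "replicate n True @ False # replicate p True @ [False]"
  let ?E = "{{i, j} |i j. i < j \<and> j < n \<and> bit_at w (adj_pos p n i j)}"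
  let ?s = "\<Sum>{..<n}"
  define u where "u = drop (n + (p + 2)) w"
  \<comment> \<open>The symbol 1 occurs only inside the input, so the test of the sign bit also
    certifies that all preceding blocks are complete.\<close>
  have len: "bound_pos p n < length w" using sign unfolding symbol_at_Suc by simp
  then have u_len: "?s + p * n < length u" by (simp add: u_def bound_pos_def)
  have "take (n + (p + 2)) w = ?H"
  proof (rule nth_equalityI)
    show "length (take (n + (p + 2)) w) = length ?H" using len by (simp add: bound_pos_def)
    fix i assume "i < length (take (n + (p + 2)) w)"
    then have i: "i < n + (p + 2)" by simp
    consider "i < n" | "i = n" | a where "a < p" "i = n + Suc a" | "i = n + Suc p"
    proof -
      have "i < n \<or> i = n \<or> (i - Suc n < p \<and> i = n + Suc (i - Suc n)) \<or> i = n + Suc p"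
        using i by linarith
      then show thesis using that by blast
    qed
    then show "take (n + (p + 2)) w ! i = ?H ! i"
      using header n i unfolding header_def symbol_at_Suc
      by cases (auto simp: nth_append nth_Cons')
  qed
  then have w: "w = ?H @ u" using append_take_drop_id[of "n + (p + 2)" w] by (simp add: u_def)
  have bit_u: "bit_at w (n + (p + 2) + i) \<longleftrightarrow> u ! i" if "i < length u" for i
    using that by (auto simp: symbol_at_Suc u_def)
  have edges: "map (\<lambda>j. map (\<lambda>i. {i, j} \<in> ?E) [0..<j]) [0..<n] =
      map (\<lambda>j. map (\<lambda>i. u ! (\<Sum>{..<j} + i)) [0..<j]) [0..<n]"
  proof (intro map_cong refl)
    fix i j assume ij: "j \<in> set [0..<n]" "i \<in> set [0..<j]"
    then have "\<Sum>{..<Suc j} \<le> ?s" by (intro sum_mono2) auto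
    then have "\<Sum>{..<j} + i < length u" using u_len ij by simp
    moreover have "{i, j} \<in> ?E \<longleftrightarrow> bit_at w (adj_pos p n i j)"
      using ij by (auto simp: doubleton_eq_iff)
    ultimately show "({i, j} \<in> ?E) = u ! (\<Sum>{..<j} + i)"
      using bit_u[of "\<Sum>{..<j} + i"] by (simp add: adj_pos_def add.assoc)
  qed
  have A: "concat (map (\<lambda>j. map (\<lambda>i. {i, j} \<in> ?E) [0..<j]) [0..<n]) = take ?s u"
    unfolding edges by (rule blocks_eq_take[of "\<lambda>j. j" n u]) (use u_len in simp)
  have parts: "map (\<lambda>a. map (\<lambda>x. x \<in> U a) [0..<n]) [0..<p] =
      map (\<lambda>a. map (\<lambda>x. drop ?s u ! (a * n + x)) [0..<n]) [0..<p]"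
  proof (intro map_cong refl)
    fix a x assume ax: "a \<in> set [0..<p]" "x \<in> set [0..<n]"
    then have "Suc a * n \<le> p * n" by (intro mult_right_mono) auto
    then have "?s + (a * n + x) < length u" using u_len ax by simp
    then show "(x \<in> U a) = drop ?s u ! (a * n + x)"
      using bit_u[of "?s + (a * n + x)"] ax by (simp add: U_def part_pos_def add.assoc)
  qed
  have P: "concat (map (\<lambda>a. map (\<lambda>x. x \<in> U a) [0..<n]) [0..<p]) = take (p * n) (drop ?s u)"
    unfolding parts using blocks_eq_take[of "\<lambda>_. n" p "drop ?s u"] u_len
    by (simp del: nth_drop)
  obtain b B where bB: "drop (bound_pos p n) w = b # B"
    using len by (cases "drop (bound_pos p n) w") auto
  have "b = w ! bound_pos p n" using bB len by (metis Cons_nth_drop_Suc list.inject)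
  then have b: "\<not> b" using sign unfolding symbol_at_Suc by simp
  have "B \<noteq> False # ys" for ys
  proof
    assume B: "B = False # ys"
    have "drop (bound_pos p n) w ! 1 = False" "1 < length (drop (bound_pos p n) w)"
      by (simp_all add: bB B)
    then show False using lead unfolding symbol_at_Suc by simp
  qed
  then obtain k where k: "B = binary k" using binary_surj by blast
  have "drop (p * n) (drop ?s u) = False # binary k"
    using bB b k by (simp add: u_def bound_pos_def add.commute add.left_commute)
  then have u: "take ?s u @ take (p * n) (drop ?s u) @ False # binary k = u"
    by (metis append_take_drop_id)
  let ?I = "\<lparr>num_vertices = n, edges = ?E, parts = map U [0..<p], color_bound = int k\<rparr>"
  have U: "map (\<lambda>a. map (\<lambda>x. x \<in> map U [0..<p] ! a) [0..<n]) [0..<p] =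
      map (\<lambda>a. map (\<lambda>x. x \<in> U a) [0..<n]) [0..<p]"
    by (intro map_cong refl) auto
  have "encode ?I = ?H @ concat (map (\<lambda>j. map (\<lambda>i. {i, j} \<in> ?E) [0..<j]) [0..<n]) @
      concat (map (\<lambda>a. map (\<lambda>x. x \<in> map U [0..<p] ! a) [0..<n]) [0..<p]) @ False # binary k"
    using encode_blocks[of ?I p] by simp
  also have "\<dots> = w" unfolding A U P u w[symmetric] ..
  finally show thesis by (rule that)
qed

text \<open>The right-hand side mentions only symbols at computed positions, literal suffixes and
  order between variables, which is what the closure properties handle. A word with the sign bit set
  can be dismissed at once because a chromatic number is never negative.\<close>

lemma pcp_language_iff:
  "(\<exists>I. w = encode I \<and> pcp_instance I \<and> length (parts I) = p \<and> pcp_yes I) \<longleftrightarrow>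
   (\<exists>n \<le> length w. header p w n \<and> partition_code p w n \<and>
      symbol_at w (Suc (bound_pos p n)) = 1 \<and> symbol_at w (Suc (Suc (bound_pos p n))) \<noteq> 1 \<and>
      (\<exists>v. (\<forall>a<p. v a \<le> length w) \<and> (\<forall>a \<in> {..<p}. v a < n \<and> bit_at w (part_pos p n a (v a))) \<and>
         (\<exists>f \<in> {..<p} \<rightarrow>\<^sub>E {..<p}.
            (\<forall>a \<in> {..<p}. \<forall>b \<in> {..<p}. f a = f b \<longrightarrow> v a < v b \<longrightarrow>
               \<not> bit_at w (adj_pos p n (v a) (v b))) \<and>
            (\<forall>c \<in> {..<p}. drop (bound_pos p n) w = False # binary c \<longrightarrow> (\<forall>a<p. f a < c)))))"
  (is "?L \<longleftrightarrow> (\<exists>n \<le> length w. header p w n \<and> partition_code p w n \<and> ?sign n \<and> ?lead n \<and> ?sol n)")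
proof -
  \<comment> \<open>Needed twice: for the instance that was encoded and for the one rebuilt from the
    word.\<close>
  have sol: "?sol n \<longleftrightarrow> pcp_yes I"
    if w: "w = encode I" and I: "pcp_instance I" "length (parts I) = p" "num_vertices I = n"
      and k: "0 \<le> color_bound I" for I n
  proof -
    note facts = encode_facts[OF I(2), folded w, unfolded I(3)]
    have drop: "drop (bound_pos p n) w = False # binary c \<longleftrightarrow> color_bound I = int c" for c
      using facts(4) k by (auto dest: binary_inj)
    have "?sol n \<longleftrightarrow> (\<exists>v. (\<forall>a<p. v a < n \<and> v a \<in> parts I ! a) \<and>
       (\<exists>f \<in> {..<p} \<rightarrow>\<^sub>E {..<p}.
          (\<forall>a<p. \<forall>b<p. f a = f b \<longrightarrow> v a < v b \<longrightarrow> {v a, v b} \<notin> edges I) \<and>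
          (\<forall>c<p. color_bound I = int c \<longrightarrow> (\<forall>a<p. f a < c))))" (is "_ \<longleftrightarrow> ?sol'")
    proof
      assume ?sol'
      then obtain v f where v: "\<forall>a<p. v a < n \<and> v a \<in> parts I ! a" and
        f: "f \<in> {..<p} \<rightarrow>\<^sub>E {..<p}"
        "\<forall>a<p. \<forall>b<p. f a = f b \<longrightarrow> v a < v b \<longrightarrow> {v a, v b} \<notin> edges I"
        "\<forall>c<p. color_bound I = int c \<longrightarrow> (\<forall>a<p. f a < c)" by blast
      have "\<forall>a<p. v a \<le> length w" using v facts(5) by force
      moreover have "\<forall>a\<in>{..<p}. v a < n \<and> bit_at w (part_pos p n a (v a))"
        using v facts(3) by (metis lessThan_iff)
      ultimately show "?sol n"
        unfolding drop using f facts(2) by (intro exI[of _ v] conjI bexI[of _ f]) auto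
    next
      assume "?sol n"
      then obtain v f where v: "\<forall>a\<in>{..<p}. v a < n \<and> bit_at w (part_pos p n a (v a))" and
        f: "f \<in> {..<p} \<rightarrow>\<^sub>E {..<p}"
        "\<forall>a\<in>{..<p}. \<forall>b\<in>{..<p}. f a = f b \<longrightarrow> v a < v b \<longrightarrow> \<not> bit_at w (adj_pos p n (v a) (v b))"
        "\<forall>c\<in>{..<p}. color_bound I = int c \<longrightarrow> (\<forall>a<p. f a < c)" unfolding drop by blast
      have "\<forall>a<p. v a < n \<and> v a \<in> parts I ! a" using v facts(3) by (metis lessThan_iff)
      then show ?sol'
        using f facts(2) by (intro exI[of _ v] conjI bexI[of _ f]) auto
    qed
    then show ?thesis using pcp_yes_iff[OF I(1,2)] k I(3) by simp
  qed
  show ?thesis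
  proof
    assume ?L
    then obtain I where w: "w = encode I" and I: "pcp_instance I" "length (parts I) = p"
      and yes: "pcp_yes I" by blast
    define n where "n = num_vertices I"
    note facts = encode_facts[OF I(2), folded w n_def]
    have k: "0 \<le> color_bound I" using yes pcp_yes_iff[OF I] by simp
    have drop: "drop (bound_pos p n) w = False # binary (nat (color_bound I))"
      using facts(4) k by simp
    have "?sign n" using symbol_at_drop[of "bound_pos p n" w 0] drop by (simp add: symbol_at_def)
    moreover have "?lead n"
    proof (cases "binary (nat (color_bound I))")
      case Nil
      then show ?thesis using symbol_at_drop[of "bound_pos p n" w 1] drop by (simp add: symbol_at_def)
    next
      case (Cons b B)
      then have b using binary_Cons_False[of "nat (color_bound I)" B] by (cases b) auto
      then show ?thesis
        using symbol_at_drop[of "bound_pos p n" w 1] drop Cons by (simp add: symbol_at_def)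
    qed
    moreover have "partition_code p w n"
    proof -
      have part: "partition_on {..<n} (set (parts I))" "distinct (parts I)"
        using I(1) by (auto simp: pcp_instance_def n_def)
      have "\<exists>a \<in> {..<p}. x \<in> parts I ! a \<and> (\<forall>b \<in> {..<p} - {a}. x \<notin> parts I ! b)" if x: "x < n" for x
      proof -
        obtain a where a: "a < p" "x \<in> parts I ! a"
          using part(1) x I(2) unfolding partition_on_def
          by (metis UnionE in_set_conv_nth lessThan_iff)
        have "x \<notin> parts I ! b" if "b \<in> {..<p} - {a}" for b
          using partition_on_nth_unique[OF part, of a b x] a I(2) that by auto
        then show ?thesis using a by blast
      qed
      moreover have "\<exists>x<n. x \<in> parts I ! a" if "a < p" for a
      proof -
        have "parts I ! a \<in> set (parts I)" using that I(2) by simp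
        then have "parts I ! a \<noteq> {}" "parts I ! a \<subseteq> {..<n}"
          using partition_onD1[OF part(1)] partition_onD3[OF part(1)] by auto
        then show ?thesis by blast
      qed
      moreover have "x \<le> length w" if "x < n" for x using that facts(5) by simp
      ultimately show ?thesis
        unfolding partition_code_def using facts(3) by (metis DiffD1 lessThan_iff)
    qed
    ultimately show "\<exists>n \<le> length w. header p w n \<and> partition_code p w n \<and> ?sign n \<and> ?lead n \<and> ?sol n"
      using facts(1,5) iffD2[OF sol[OF w I n_def[symmetric] k] yes]
      by (intro exI[of _ n] conjI)
  next
    assume "\<exists>n \<le> length w. header p w n \<and> partition_code p w n \<and> ?sign n \<and> ?lead n \<and> ?sol n"
    then obtain n where n: "n \<le> length w" "header p w n" and part: "partition_code p w n"
      and sgn: "?sign n" "?lead n" and sol_n: "?sol n" by blast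
    define U where "U = (\<lambda>a. {x. x < n \<and> bit_at w (part_pos p n a x)})"
    obtain k where enc: "encode \<lparr>num_vertices = n,
        edges = {{i, j} |i j. i < j \<and> j < n \<and> bit_at w (adj_pos p n i j)},
        parts = map U [0..<p], color_bound = int k\<rparr> = w" (is "encode ?I = w")
      by (rule decode[OF n(2,1) sgn, folded U_def]) (rule that)
    have U: "x \<in> U a \<longleftrightarrow> x < n \<and> bit_at w (part_pos p n a x)" for a x by (simp add: U_def)
    have ex1: "\<exists>a \<in> {..<p}. x \<in> U a \<and> (\<forall>b \<in> {..<p} - {a}. x \<notin> U b)" if "x < n" for x
    proof -
      have "x \<le> length w" using that n(1) by simp
      then show ?thesis using part that unfolding partition_code_def U by simp
    qed
    have ne: "\<exists>x. x \<in> U a" if "a < p" for a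
    proof -
      have "\<exists>x \<le> length w. x < n \<and> bit_at w (part_pos p n a x)"
        using part that unfolding partition_code_def by (metis lessThan_iff)
      then show ?thesis unfolding U by blast
    qed
    have disj: "a = b" if "a < p" "b < p" "x \<in> U a" "x \<in> U b" for a b x
    proof -
      have "x < n" using that(3) by (simp add: U)
      from ex1[OF this] obtain c where "\<forall>b \<in> {..<p} - {c}. x \<notin> U b" by blast
      then show ?thesis using that by (metis DiffI lessThan_iff singletonD)
    qed
    have "inj_on U {..<p}" by (rule inj_onI) (metis ne disj lessThan_iff)
    then have "distinct (map U [0..<p])" by (simp add: distinct_map atLeast0LessThan)
    moreover have "partition_on {..<n} (set (map U [0..<p]))"
    proof (rule partition_onI)
      have "U a \<subseteq> {..<n}" for a by (auto simp: U)
      moreover have "\<exists>a \<in> {..<p}. x \<in> U a" if "x < n" for x using ex1[OF that] by blast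
      ultimately show "\<Union> (set (map U [0..<p])) = {..<n}" by fastforce
    next
      fix X Y assume XY: "X \<in> set (map U [0..<p])" "Y \<in> set (map U [0..<p])" and "X \<noteq> Y"
      from XY obtain a b where "a < p" "X = U a" "b < p" "Y = U b"
        by (metis imageE list.set_map atLeastLessThan_iff set_upt)
      then show "disjnt X Y" using disj[of a b] \<open>X \<noteq> Y\<close> unfolding disjnt_iff by blast
    next
      show "{} \<notin> set (map U [0..<p])" using ne by fastforce
    qed
    moreover have "simple_graph {..<n} (edges ?I)"
      by (auto simp: simple_graph_def card_2_iff)
    ultimately have I: "pcp_instance ?I" by (simp add: pcp_instance_def)
    have "pcp_yes ?I" by (rule iffD1[OF sol sol_n]) (use enc I in simp_all)
    then show ?L using enc I by (intro exI[of _ ?I]) simp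
  qed
qed

text \<open>For a fixed word \<open>xs\<close> this is a finite conjunction. The final blank pins
  down the end of the input, so a longer numeral with prefix \<open>xs\<close> does not
  match.\<close>

lemma decidable_drop_eq:
  assumes "computable t"
  shows "decidable (\<lambda>w e. drop (t w e) w = xs)"
proof -
  have iff: "drop m w = xs \<longleftrightarrow>
      (\<forall>i \<in> {..<length xs}. symbol_at w (Suc (i + m)) = (if xs ! i then 2 else 1)) \<and>
      symbol_at w (Suc (length xs + m)) = 0" (is "?L \<longleftrightarrow> ?R") for m w
  proof
    assume ?L
    then show ?R by (auto simp: symbol_at_def add.commute)
  next
    assume R: ?R
    have i: "m + i < length w \<and> w ! (m + i) = xs ! i" if "i < length xs" for i
    proof -
      have "symbol_at w (Suc (m + i)) = (if xs ! i then 2 else 1)"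
        using R that by (simp add: add.commute)
      then show ?thesis by (auto simp: symbol_at_def split: if_splits)
    qed
    have "length w \<le> length xs + m" using R by simp
    moreover have "length xs \<le> length w - m" using i[of "length xs - 1"] by (cases xs) auto
    ultimately show ?L using i by (intro nth_equalityI) auto
  qed
  show ?thesis
    unfolding iff by (intro decidable_and decidable_finite_all decidable_symbol_at computable_Suc
        computable_add computable_const assms finite_lessThan)
qed

theorem theorem6:
  fixes p :: nat
  shows "polynomial_time_decidable
           {encode I | I. pcp_instance I \<and> length (parts I) = p \<and> pcp_yes I}"
proof (rule decidable_polynomial_time)
  text \<open>Variable \<open>a < p\<close> holds the vertex selected from part \<open>a\<close>, variable \<open>p\<close> the number of vertices
    and variable \<open>Suc p\<close> the vertex \<open>x\<close> bound in the preliminary checks.\<close>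
  note computable = computable_Suc computable_add computable_const computable_mult_const
    computable_sum_var computable_var
  have adj: "computable (\<lambda>w e. adj_pos p (e p) (e i) (e j))" for i j
    unfolding adj_pos_def by (intro computable)
  have part: "computable (\<lambda>w e. part_pos p (e p) a (e i))" for a i
    unfolding part_pos_def by (intro computable)
  have bound: "computable (\<lambda>w e. bound_pos p (e p))"
    unfolding bound_pos_def by (intro computable)
  note decidable = decidable_and decidable_not decidable_imp decidable_finite_all decidable_finite_ex
    decidable_symbol_at decidable_drop_eq decidable_less decidable_const computable_Suc adj part bound
    finite_lessThan finite_Diff finite_PiE
  have header: "decidable (\<lambda>w e. header p w (e p))"
  proof -
    \<comment> \<open>The updates are written out so that the body has the form of a predicate on
      the environment \<open>e(Suc p := x)\<close>, as \<open>decidable_all\<close>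
      requires.\<close>
    have "decidable (\<lambda>w e. \<forall>x \<le> length w. (e(Suc p := x)) (Suc p) < (e(Suc p := x)) p \<longrightarrow>
        bit_at w ((e(Suc p := x)) (Suc p)))"
      by (rule decidable_all) (intro decidable computable)
    then have 1: "decidable (\<lambda>w e. \<forall>x \<le> length w. x < e p \<longrightarrow> bit_at w x)" by simp
    show ?thesis unfolding header_def by (intro 1 decidable computable)
  qed
  have partition: "decidable (\<lambda>w e. partition_code p w (e p))"
  proof -
    have "decidable (\<lambda>w e. \<forall>x \<le> length w. (e(Suc p := x)) (Suc p) < (e(Suc p := x)) p \<longrightarrow>
        (\<exists>a \<in> {..<p}. bit_at w (part_pos p ((e(Suc p := x)) p) a ((e(Suc p := x)) (Suc p))) \<and>
           (\<forall>b \<in> {..<p} - {a}. \<not> bit_at w (part_pos p ((e(Suc p := x)) p) b ((e(Suc p := x)) (Suc p))))))"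
      by (rule decidable_all) (intro decidable)
    then have 1: "decidable (\<lambda>w e. \<forall>x \<le> length w. x < e p \<longrightarrow>
        (\<exists>a \<in> {..<p}. bit_at w (part_pos p (e p) a x) \<and>
           (\<forall>b \<in> {..<p} - {a}. \<not> bit_at w (part_pos p (e p) b x))))" by simp
    have "decidable (\<lambda>w e. \<exists>x \<le> length w. (e(Suc p := x)) (Suc p) < (e(Suc p := x)) p \<and>
        bit_at w (part_pos p ((e(Suc p := x)) p) a ((e(Suc p := x)) (Suc p))))" for a
      by (rule decidable_ex) (intro decidable)
    then have 2: "decidable (\<lambda>w e. \<exists>x \<le> length w. x < e p \<and> bit_at w (part_pos p (e p) a x))" for a
      by simp
    show ?thesis unfolding partition_code_def by (intro 1 2 decidable)
  qed
  let ?sol = "\<lambda>w n v. (\<forall>a \<in> {..<p}. v a < n \<and> bit_at w (part_pos p n a (v a))) \<and>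
     (\<exists>f \<in> {..<p} \<rightarrow>\<^sub>E {..<p}.
        (\<forall>a \<in> {..<p}. \<forall>b \<in> {..<p}. f a = f b \<longrightarrow> v a < v b \<longrightarrow>
           \<not> bit_at w (adj_pos p n (v a) (v b))) \<and>
        (\<forall>c \<in> {..<p}. drop (bound_pos p n) w = False # binary c \<longrightarrow> (\<forall>a<p. f a < c)))"
  \<comment> \<open>The environment itself first serves as the choice of vertices;
    \<open>decidable_ex_fun\<close> then binds its variables below \<open>p\<close>.\<close>
  have "decidable (\<lambda>w e. ?sol w (e p) e)" by (intro decidable)
  from decidable_ex_fun[OF this, of p]
  have sol: "decidable (\<lambda>w e. \<exists>v. (\<forall>a<p. v a \<le> length w) \<and> ?sol w (e p) v)"
    by (simp cong: conj_cong)
  let ?Q = "\<lambda>w n. header p w n \<and> partition_code p w n \<and>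
      symbol_at w (Suc (bound_pos p n)) = 1 \<and> symbol_at w (Suc (Suc (bound_pos p n))) \<noteq> 1 \<and>
      (\<exists>v. (\<forall>a<p. v a \<le> length w) \<and> ?sol w n v)"
  have "decidable (\<lambda>w e. ?Q w (e p))"
    by (intro header partition sol decidable)
  \<comment> \<open>Binding the last free variable, the number of vertices, leaves a predicate of
    the word alone.\<close>
  from decidable_ex[OF this, of p] have "decidable (\<lambda>w e. \<exists>n \<le> length w. ?Q w n)"
    by simp
  then show "decidable (\<lambda>w _. w \<in> {encode I | I. pcp_instance I \<and> length (parts I) = p \<and> pcp_yes I})"
    using pcp_language_iff[of _ p] by simp
qed

end
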